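(* Let $$A=\log\mathfrak a,\qquad B=\log b,\qquad C=\log c,$$ and let a dot denote differentiation with respect to $y=\log R$. Set $$\eta_H=\frac{\mathfrak a}{b},\qquad\eta_V=\frac{\mathfrak a}{c},\qquad Z=\dot A\,\alpha^2+\dot B\,\beta+\dot C\,\gamma .$$ Then, at every point $x\in M\setminus\{o\}$ and for every unit vector $\nu\in T_xM$ with $\Pi=\nu^\perp$, $$\begin{aligned}\mathscr T_{p,q}:={}&\sum_{j=1}^nJ_\Pi''(0,\varphi_j)-nJ_\Pi'(0,1)\\={}&-nZ-Z^2+\alpha^2\left(-\ddot A+2\dot A^2+\eta_H^2(p-\beta)+\eta_V^2(q-\gamma)\right)\\&+\beta(-\ddot B+2\dot B^2)+\gamma(-\ddot C+2\dot C^2).\end{aligned}$$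
   Context: $M$ is one of $\mathbb C\mathrm H^m$, $\mathbb H\mathrm H^m$, $\mathbb O\mathrm H^2$, with real dimension $n=p+q+1$, where $(p,q)=(2m-2,1)$, $(4m-4,3)$, $(8,7)$ respectively. The metric $g$ is normalized so that for every unit $\theta\in T_oM$ the operator $X\mapsto R(X,\theta)\theta$ on $\theta^\perp$ has sectional-curvature eigenvalues $-1$ (multiplicity $p$) and $-4$ (multiplicity $q$). Fix $o\in M$; $\mathbb S_o^{n-1}\subset T_oM$ is the unit sphere with its round metric, and $T_\theta\mathbb S_o^{n-1}=\mathcal H_\theta\oplus\mathcal V_\theta$ is the orthogonal splitting into the $-1$ and $-4$ eigenspaces ($\dim\mathcal H_\theta=p$, $\dim\mathcal V_\theta=q$). In geodesic polar coordinates $(r,\theta)$ about $o$, $g=dr^2+\sinh^2r\,g_{\mathcal H}+\sinh^2r\cosh^2r\,g_{\mathcal V}$, with $g_{\mathcal H},g_{\mathcal V}$ the restrictions of the round metric. The volume radius $R=R(r)$ is defined by $R(r)^n=n\int_0^r\sinh^{n-1}s\cosh^qs\,ds$. Put $y=\log R$ and, as functions of $y$, $\mathfrak a=dr/dy$, $b=\sinh r$, $c=\sinh r\cosh r$. For $\varphi\in C^1(\mathbb S_o^{n-1})$ let $F_{t,\varphi}(y,\theta)=(y+t\varphi(\theta),\theta)$ (in coordinates $(y,\theta)$ on $M\setminus\{o\}$). For $x\in M\setminus\{o\}$ and a unit $\nu\in T_xM$ write $\nu=\alpha N+v+w$, where $N=\partial_r$ and $v,w$ lie in the subspaces of the tangent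 space to the geodesic sphere corresponding to $\mathcal H_\theta$, $\mathcal V_\theta$; $\beta=|v|^2$, $\gamma=|w|^2$, so $\alpha^2+\beta+\gamma=1$. Put $\Pi=\nu^\perp$ and $J_\Pi(t,\varphi)=|\operatorname{cof}DF_{t,\varphi}(x)\,\nu|$, where $\operatorname{cof}L=(\det L)L^{-T}$ with respect to $g$ at source and target; this is the $(n-1)$-dimensional Jacobian of $DF_{t,\varphi}(x)|_\Pi$. Primes on $J_\Pi$ are $t$-derivatives, $1$ is the constant function $\varphi\equiv1$, and $\varphi_j(\theta)=\langle\theta,e_j\rangle$ for an orthonormal basis $e_1,\dots,e_n$ of $T_oM$. *)

theory Defs
  imports "HOL-Analysis.Analysis"
begin

text \<open>All tangent spaces are identified with \<^typ>\<open>real^'n\<close>, and \<open>g x u v\<close> is the inner product of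
  the tangent vectors \<open>u\<close> and \<open>v\<close> at \<open>x\<close>.\<close>

type_synonym 'n metric = "real^'n \<Rightarrow> real^'n \<Rightarrow> real^'n \<Rightarrow> real"

definition gram :: "'n::finite metric \<Rightarrow> real^'n \<Rightarrow> real^'n^'n" where
  "gram g x = (\<chi> i j. g x (axis i 1) (axis j 1))"

definition metric_norm :: "'n::finite metric \<Rightarrow> real^'n \<Rightarrow> real^'n \<Rightarrow> real" where
  "metric_norm g x u = sqrt (g x u u)"

text \<open>\<open>christoffel g x u v\<close> is the value at \<open>x\<close> of the Levi-Civita derivative
  \<open>\<nabla>\<^sub>u v\<close> of the constant vector field \<open>v\<close>, given by the Koszul formula.\<close>

definition christoffel :: "'n::finite metric \<Rightarrow> real^'n \<Rightarrow> real^'n \<Rightarrow> real^'n \<Rightarrow> real^'n" where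
  "christoffel g x u v = matrix_inv (gram g x) *v
     (\<chi> k. (frechet_derivative (\<lambda>z. g z v (axis k 1)) (at x) u
          + frechet_derivative (\<lambda>z. g z u (axis k 1)) (at x) v
          - frechet_derivative (\<lambda>z. g z u v) (at x) (axis k 1)) / 2)"

text \<open>Sign convention: \<open>R(X,Y)Z = \<nabla>\<^sub>X\<nabla>\<^sub>Y Z - \<nabla>\<^sub>Y\<nabla>\<^sub>X Z - \<nabla>\<^bsub>[X,Y]\<^esub> Z\<close>,
  evaluated on constant vector fields, so that the sectional curvature of an orthonormal pair is
  \<open>\<langle>R(X,Y)Y,X\<rangle>\<close>.\<close>

definition curvature ::
  "'n::finite metric \<Rightarrow> real^'n \<Rightarrow> real^'n \<Rightarrow> real^'n \<Rightarrow> real^'n \<Rightarrow> real^'n" where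
  "curvature g x X Y Z =
     frechet_derivative (\<lambda>z. christoffel g z Y Z) (at x) X
   - frechet_derivative (\<lambda>z. christoffel g z X Z) (at x) Y
   + christoffel g x X (christoffel g x Y Z)
   - christoffel g x Y (christoffel g x X Z)"

text \<open>For a linear map with matrix \<open>T\<close> from the tangent space at \<open>x\<close> to the one at \<open>y\<close>: its
  determinant in positively oriented orthonormal bases, its adjoint (from the tangent space at
  \<open>y\<close> to the one at \<open>x\<close>), and its cofactor map \<open>(det T) T\<^sup>-\<^sup>T\<close>, all with respect to \<open>g\<close>.\<close>

definition metric_det :: "'n::finite metric \<Rightarrow> real^'n \<Rightarrow> real^'n \<Rightarrow> real^'n^'n \<Rightarrow> real" where
  "metric_det g x y T = det T * sqrt (det (gram g y)) / sqrt (det (gram g x))"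

definition metric_adjoint ::
  "'n::finite metric \<Rightarrow> real^'n \<Rightarrow> real^'n \<Rightarrow> real^'n^'n \<Rightarrow> real^'n^'n" where
  "metric_adjoint g x y T = matrix_inv (gram g x) ** transpose T ** gram g y"

definition metric_cof ::
  "'n::finite metric \<Rightarrow> real^'n \<Rightarrow> real^'n \<Rightarrow> real^'n^'n \<Rightarrow> real^'n^'n" where
  "metric_cof g x y T = metric_det g x y T *\<^sub>R matrix_inv (metric_adjoint g x y T)"

text \<open>Let \<open>L x\<close> be the \<open>\<K>\<close>-line through \<open>x\<close>. The unit ball carries the (Bergman-type) metric that is
  \<open>(1 - |x|\<^sup>2)\<^sup>-\<^sup>2\<close> times the Euclidean one on \<open>L x\<close> and \<open>(1 - |x|\<^sup>2)\<^sup>-\<^sup>1\<close> times the Euclidean one on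
  the orthogonal complement of \<open>L x\<close>; it is written below so as to be visibly regular at 0, since
  \<open>|x|\<^sup>2\<close> times the orthogonal projection onto \<open>L x\<close> is quadratic in \<open>x\<close>. The sectional curvature
  lies between \<open>-4\<close> and \<open>-1\<close>, and the metric at the centre 0, which plays the role of the base
  point \<open>o\<close>, is the Euclidean one.\<close>

definition ball_metric :: "(real^'n::finite \<Rightarrow> (real^'n) set) \<Rightarrow> 'n metric" where
  "ball_metric L x u v =
     (u \<bullet> v) / (1 - (norm x)\<^sup>2)
   + (norm x)\<^sup>2 * (closest_point (L x) u \<bullet> closest_point (L x) v) / (1 - (norm x)\<^sup>2)\<^sup>2"

definition complex_hyperbolic :: "nat \<Rightarrow> 'n::finite metric \<Rightarrow> bool" where
  "complex_hyperbolic m g \<longleftrightarrow> CARD('n) = 2 * m \<and>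
     (\<exists>J. orthogonal_transformation J \<and> (\<forall>x. J (J x) = - x) \<and>
          g = ball_metric (\<lambda>x. span {x, J x}))"

definition quaternionic_hyperbolic :: "nat \<Rightarrow> 'n::finite metric \<Rightarrow> bool" where
  "quaternionic_hyperbolic m g \<longleftrightarrow> CARD('n) = 4 * m \<and>
     (\<exists>I J. orthogonal_transformation I \<and> orthogonal_transformation J \<and>
          (\<forall>x. I (I x) = - x) \<and> (\<forall>x. J (J x) = - x) \<and> (\<forall>x. I (J x) = - J (I x)) \<and>
          g = ball_metric (\<lambda>x. span {x, I x, J x, I (J x)}))"

text \<open>Octonions, by two Cayley-Dickson doublings of the complex numbers. The Euclidean structure
  is that of the product type.\<close>

type_synonym quat = "complex \<times> complex"
type_synonym oct = "quat \<times> quat"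

fun qcnj :: "quat \<Rightarrow> quat" where
  "qcnj (a, b) = (cnj a, - b)"

fun qmult :: "quat \<Rightarrow> quat \<Rightarrow> quat" where
  "qmult (a, b) (c, d) = (a * c - cnj d * b, d * a + b * cnj c)"

fun ocnj :: "oct \<Rightarrow> oct" where
  "ocnj (a, b) = (qcnj a, - b)"

fun omult :: "oct \<Rightarrow> oct \<Rightarrow> oct" where
  "omult (a, b) (c, d) =
     (qmult a c - qmult (qcnj d) b, qmult d a + qmult b (qcnj c))"

definition oinv :: "oct \<Rightarrow> oct" where
  "oinv a = ocnj a /\<^sub>R (norm a)\<^sup>2"

text \<open>The octonionic lines in the octonionic plane are \<open>{(u, s u)}\<close> for a slope \<open>s\<close>, together with
  \<open>{(0, u)}\<close>.\<close>

fun octonionic_line :: "oct \<times> oct \<Rightarrow> (oct \<times> oct) set" where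
  "octonionic_line (a, b) =
     (if a = 0 then {0} \<times> UNIV else range (\<lambda>u. (u, omult (omult b (oinv a)) u)))"

definition octonionic_hyperbolic_plane :: "'n::finite metric \<Rightarrow> bool" where
  "octonionic_hyperbolic_plane g \<longleftrightarrow> CARD('n) = 16 \<and>
     (\<exists>\<Phi> :: real^'n \<Rightarrow> oct \<times> oct. linear \<Phi> \<and> (\<forall>x. norm (\<Phi> x) = norm x) \<and>
          g = ball_metric (\<lambda>x. {u. \<Phi> u \<in> octonionic_line (\<Phi> x)}))"

text \<open>\<open>r \<mapsto> polar r \<theta>\<close> is the unit speed geodesic from 0 with initial velocity \<open>\<theta>\<close>, and
  \<open>(rad x, dir x)\<close> are the polar coordinates of \<open>x\<close>.\<close>

definition polar :: "real \<Rightarrow> real^'n::finite \<Rightarrow> real^'n" where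
  "polar r \<theta> = tanh r *\<^sub>R \<theta>"

definition rad :: "real^'n::finite \<Rightarrow> real" where
  "rad x = artanh (norm x)"

definition dir :: "real^'n::finite \<Rightarrow> real^'n" where
  "dir x = x /\<^sub>R norm x"

lemma polar_rad_dir:
  assumes "x \<in> ball 0 1 - {0}"
  shows "polar (rad x) (dir x) = x"
proof -
  define u where "u = norm x"
  have u: "0 < u" "u < 1" using assms by (auto simp: u_def)
  have "exp (- 2 * artanh u) = inverse ((1 + u) / (1 - u))"
    using u by (simp add: artanh_def exp_minus)
  hence "tanh (artanh u) = u"
    using u by (simp only: tanh_real_altdef) (simp add: field_simps)
  thus ?thesis using u by (simp add: polar_def rad_def dir_def u_def)
qed

text \<open>The metric in polar coordinates is
  \<open>dr\<^sup>2 + sinh\<^sup>2 r g\<^sub>H + sinh\<^sup>2 r cosh\<^sup>2 r g\<^sub>V\<close>.\<close>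

lemma ball_metric_polar:
  fixes \<theta> h k :: "real^'n::finite"
  assumes \<theta>: "norm \<theta> = 1"
    and L: "subspace (L \<theta>)" "\<theta> \<in> L \<theta>" "L (polar r \<theta>) = L \<theta>"
    and h: "\<forall>u\<in>L \<theta>. h \<bullet> u = 0" and k: "k \<in> L \<theta>" "k \<bullet> \<theta> = 0"
    and X: "X = \<rho> *\<^sub>R vector_derivative (\<lambda>s. polar s \<theta>) (at r)
              + frechet_derivative (polar r) (at \<theta>) (h + k)"
  shows "ball_metric L (polar r \<theta>) X X
       = \<rho>\<^sup>2 + (sinh r)\<^sup>2 * (norm h)\<^sup>2 + (sinh r)\<^sup>2 * (cosh r)\<^sup>2 * (norm k)\<^sup>2"
proof -
  define t where "t = tanh r"
  define a where "a = \<rho> * (1 - t\<^sup>2)"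
  have vd: "vector_derivative (\<lambda>s. polar s \<theta>) (at r) = (1 - t\<^sup>2) *\<^sub>R \<theta>"
    unfolding polar_def t_def
  proof (rule vector_derivative_at)
    have "cosh r \<noteq> 0" using cosh_real_pos[of r] by simp
    thus "((\<lambda>s. tanh s *\<^sub>R \<theta>) has_vector_derivative (1 - (tanh r)\<^sup>2) *\<^sub>R \<theta>) (at r)"
      by (auto intro!: derivative_eq_intros)
  qed
  have "(polar r has_derivative (\<lambda>u. t *\<^sub>R u)) (at \<theta>)"
    unfolding polar_def t_def by (auto intro!: derivative_eq_intros)
  hence fd: "frechet_derivative (polar r) (at \<theta>) = (\<lambda>u. t *\<^sub>R u)"
    by (rule frechet_derivative_at[symmetric])
  have X': "X = (a *\<^sub>R \<theta> + t *\<^sub>R k) + t *\<^sub>R h"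
    unfolding X vd fd a_def by (simp add: algebra_simps)
  have inL: "a *\<^sub>R \<theta> + t *\<^sub>R k \<in> L \<theta>"
    using L k by (simp add: subspace_add subspace_mul)
  have P: "closest_point (L \<theta>) X = a *\<^sub>R \<theta> + t *\<^sub>R k"
  proof (rule closest_point_unique[symmetric])
    show "convex (L \<theta>)" "closed (L \<theta>)"
      using L(1) by (auto simp: subspace_imp_convex closed_subspace)
    show "\<forall>z\<in>L \<theta>. dist X (a *\<^sub>R \<theta> + t *\<^sub>R k) \<le> dist X z"
    proof
      fix z assume "z \<in> L \<theta>"
      define u where "u = a *\<^sub>R \<theta> + t *\<^sub>R k - z"
      have "u \<in> L \<theta>" unfolding u_def using inL \<open>z \<in> L \<theta>\<close> L(1) by (rule_tac subspace_diff)
      hence "orthogonal u (t *\<^sub>R h)" using h by (simp add: orthogonal_def inner_commute[of _ h])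
      hence "(norm (u + t *\<^sub>R h))\<^sup>2 = (norm u)\<^sup>2 + (norm (t *\<^sub>R h))\<^sup>2" by (rule norm_add_Pythagorean)
      hence "(norm (t *\<^sub>R h))\<^sup>2 \<le> (norm (u + t *\<^sub>R h))\<^sup>2" by simp
      hence "norm (t *\<^sub>R h) \<le> norm (u + t *\<^sub>R h)" by (rule power2_le_imp_le) simp
      moreover have "X - z = u + t *\<^sub>R h" "X - (a *\<^sub>R \<theta> + t *\<^sub>R k) = t *\<^sub>R h"
        by (simp_all add: X' u_def)
      ultimately show "dist X (a *\<^sub>R \<theta> + t *\<^sub>R k) \<le> dist X z"
        by (simp only: dist_norm)
    qed
  qed (rule inL)
  have \<theta>\<theta>: "\<theta> \<bullet> \<theta> = 1" using \<theta> by (simp add: norm_eq_1)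
  have hk: "h \<bullet> k = 0" "h \<bullet> \<theta> = 0" "k \<bullet> h = 0" "\<theta> \<bullet> h = 0" "\<theta> \<bullet> k = 0"
    using h k L(2) by (auto simp: inner_commute)
  have PP: "(a *\<^sub>R \<theta> + t *\<^sub>R k) \<bullet> (a *\<^sub>R \<theta> + t *\<^sub>R k) = a\<^sup>2 + t\<^sup>2 * (norm k)\<^sup>2"
    using hk k(2) by (simp add: inner_add_left inner_add_right \<theta>\<theta> power2_norm_eq_inner) (simp add: power2_eq_square)
  have XX: "X \<bullet> X = a\<^sup>2 + t\<^sup>2 * (norm h)\<^sup>2 + t\<^sup>2 * (norm k)\<^sup>2"
    unfolding X' using hk k(2)
    by (simp add: inner_add_left inner_add_right \<theta>\<theta> power2_norm_eq_inner) (simp add: power2_eq_square)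
  have nrm: "(norm (polar r \<theta>))\<^sup>2 = t\<^sup>2" by (simp add: polar_def \<theta> t_def)
  have c: "cosh r \<noteq> 0" using cosh_real_pos[of r] by simp
  have d: "1 - t\<^sup>2 = 1 / (cosh r)\<^sup>2"
  proof -
    have "1 - t\<^sup>2 = ((cosh r)\<^sup>2 - (sinh r)\<^sup>2) / (cosh r)\<^sup>2"
      using c by (simp add: t_def tanh_def power_divide diff_divide_distrib)
    thus ?thesis by (simp add: cosh_square_eq)
  qed
  have ts: "t\<^sup>2 = (sinh r)\<^sup>2 / (cosh r)\<^sup>2" by (simp add: t_def tanh_def power_divide)
  have d0: "1 - t\<^sup>2 \<noteq> 0" using d c by simp
  have "ball_metric L (polar r \<theta>) X X
      = (a\<^sup>2 + t\<^sup>2 * (norm h)\<^sup>2 + t\<^sup>2 * (norm k)\<^sup>2) / (1 - t\<^sup>2)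
        + t\<^sup>2 * (a\<^sup>2 + t\<^sup>2 * (norm k)\<^sup>2) / (1 - t\<^sup>2)\<^sup>2"
    unfolding ball_metric_def L(3) P nrm PP XX ..
  also have "\<dots> = (a\<^sup>2 + t\<^sup>2 * (norm k)\<^sup>2) / (1 - t\<^sup>2)\<^sup>2 + t\<^sup>2 * (norm h)\<^sup>2 / (1 - t\<^sup>2)"
    using d0 by (simp add: divide_simps) (simp add: algebra_simps power2_eq_square)
  also have "\<dots> = \<rho>\<^sup>2 + t\<^sup>2 * (norm k)\<^sup>2 / (1 - t\<^sup>2)\<^sup>2 + t\<^sup>2 * (norm h)\<^sup>2 / (1 - t\<^sup>2)"
    using d0 by (simp add: a_def add_divide_distrib power_mult_distrib)
  also have "\<dots> = \<rho>\<^sup>2 + (sinh r)\<^sup>2 * (norm h)\<^sup>2 + (sinh r)\<^sup>2 * (cosh r)\<^sup>2 * (norm k)\<^sup>2"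
    unfolding d unfolding ts using c by (simp add: power2_eq_square)
  finally show ?thesis .
qed

text \<open>The radial unit field \<open>\<partial>\<^sub>r\<close>.\<close>

definition radial :: "real^'n::finite \<Rightarrow> real^'n" where
  "radial x = vector_derivative (\<lambda>r. polar r (dir x)) (at (rad x))"

text \<open>The \<open>-1\<close> and \<open>-4\<close> eigenspaces of \<open>X \<mapsto> R(X,\<theta>)\<theta>\<close> on the orthogonal complement of the unit
  vector \<open>\<theta>\<close> in the tangent space at 0.\<close>

definition hspace :: "'n::finite metric \<Rightarrow> real^'n \<Rightarrow> (real^'n) set" where
  "hspace g \<theta> = {X. g 0 X \<theta> = 0 \<and> curvature g 0 X \<theta> \<theta> = - X}"

definition vspace :: "'n::finite metric \<Rightarrow> real^'n \<Rightarrow> (real^'n) set" where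
  "vspace g \<theta> = {X. g 0 X \<theta> = 0 \<and> curvature g 0 X \<theta> \<theta> = - 4 *\<^sub>R X}"

text \<open>The corresponding subspaces of the tangent space at \<open>x\<close> of the geodesic sphere through \<open>x\<close>:
  images under the derivative of \<open>\<theta> \<mapsto> polar r \<theta>\<close>.\<close>

definition hspace_at :: "'n::finite metric \<Rightarrow> real^'n \<Rightarrow> (real^'n) set" where
  "hspace_at g x = frechet_derivative (polar (rad x)) (at (dir x)) ` hspace g (dir x)"

definition vspace_at :: "'n::finite metric \<Rightarrow> real^'n \<Rightarrow> (real^'n) set" where
  "vspace_at g x = frechet_derivative (polar (rad x)) (at (dir x)) ` vspace g (dir x)"

definition vol_radius :: "nat \<Rightarrow> nat \<Rightarrow> real \<Rightarrow> real" where
  "vol_radius n q r = root n (real n * integral {0..r} (\<lambda>s. sinh s ^ (n - 1) * cosh s ^ q))"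

definition log_radius :: "nat \<Rightarrow> nat \<Rightarrow> real \<Rightarrow> real" where
  "log_radius n q r = ln (vol_radius n q r)"

text \<open>The inverse function: \<open>r\<close> as a function of \<open>y = log R\<close>.\<close>

definition r_of :: "nat \<Rightarrow> nat \<Rightarrow> real \<Rightarrow> real" where
  "r_of n q y = (THE r. 0 < r \<and> log_radius n q r = y)"

definition a_fun :: "nat \<Rightarrow> nat \<Rightarrow> real \<Rightarrow> real" where
  "a_fun n q y = deriv (r_of n q) y"

definition b_fun :: "nat \<Rightarrow> nat \<Rightarrow> real \<Rightarrow> real" where
  "b_fun n q y = sinh (r_of n q y)"

definition c_fun :: "nat \<Rightarrow> nat \<Rightarrow> real \<Rightarrow> real" where
  "c_fun n q y = sinh (r_of n q y) * cosh (r_of n q y)"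

text \<open>In coordinates \<open>(y, \<theta>)\<close> the deformation is \<open>(y, \<theta>) \<mapsto> (y + t \<phi>(\<theta>), \<theta>)\<close>. Only the values of
  \<open>\<phi>\<close> on the unit sphere matter. Here \<open>n = CARD('n)\<close>.\<close>

definition deform :: "nat \<Rightarrow> real \<Rightarrow> (real^'n::finite \<Rightarrow> real) \<Rightarrow> real^'n \<Rightarrow> real^'n" where
  "deform q t \<phi> x =
     polar (r_of CARD('n) q (log_radius CARD('n) q (rad x) + t * \<phi> (dir x))) (dir x)"

definition Jac ::
  "'n::finite metric \<Rightarrow> nat \<Rightarrow> real^'n \<Rightarrow> real^'n \<Rightarrow> real \<Rightarrow> (real^'n \<Rightarrow> real) \<Rightarrow> real" where
  "Jac g q x \<nu> t \<phi> =
     (let F = deform q t \<phi>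
      in metric_norm g (F x) (metric_cof g x (F x) (jacobian F (at x)) *v \<nu>))"

end

theory Submission
  imports Defs
begin

text \<open>In the coordinates \<open>(y, \<theta>)\<close> the deformation only moves points along the rays from the centre, so
  in orthonormal frames adapted to the splitting \<open>\<real> N \<oplus> \<H> \<oplus> \<V>\<close> its differential is triangular: writing
  \<open>a', b', c'\<close> for the values of \<open>a, b, c\<close> at \<open>y' = y + t \<phi>(\<theta>)\<close>, it scales \<open>N\<close> by \<open>a'/a\<close>, \<open>\<H>\<close> by
  \<open>b'/b\<close>, \<open>\<V>\<close> by \<open>c'/c\<close>, and it adds the shear \<open>t a' d\<phi>\<close> in the direction \<open>N\<close>. The definition of the
  volume radius says exactly that \<open>a b\<^sup>p c\<^sup>q = exp (n y)\<close>, so the determinant is \<open>exp (n t \<phi>)\<close>, and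
  inverting the transposed triangular matrix gives, with \<open>V, W\<close> the components of \<open>\<nu>\<close> in \<open>\<H>, \<V>\<close>,
  \<open>J(t) = exp (n t \<phi>) sqrt (\<alpha>\<^sup>2 (a/a')\<^sup>2 + (b/b')\<^sup>2 |V - t \<alpha> \<eta>\<^sub>H \<nabla>\<^sub>H \<phi>|\<^sup>2 + (c/c')\<^sup>2 |W - t \<alpha> \<eta>\<^sub>V \<nabla>\<^sub>V \<phi>|\<^sup>2)\<close>.
  This is \<open>Jac_eq\<close>; it holds for all real \<open>t\<close> because \<open>log_radius\<close> maps the positive half-line onto
  the whole line.

  The expansion of \<open>J\<close> to second order at \<open>t = 0\<close> is \<open>second_order_Jacobian\<close>. In the sum over the
  functions \<open>\<phi>\<^sub>j(\<theta>) = \<theta> \<bullet> e\<^sub>j\<close> the identities \<open>\<Sum> \<phi>\<^sub>j\<^sup>2 = 1\<close>, \<open>\<Sum> \<phi>\<^sub>j \<nabla>\<phi>\<^sub>j = 0\<close> and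
  \<open>\<Sum> (u \<bullet> \<nabla>\<phi>\<^sub>j)\<^sup>2 = |u|\<^sup>2\<close> for tangential \<open>u\<close> remove every mixed term, while
  \<open>\<Sum> |\<nabla>\<^sub>H \<phi>\<^sub>j|\<^sup>2\<close> and \<open>\<Sum> |\<nabla>\<^sub>V \<phi>\<^sub>j|\<^sup>2\<close> are the traces \<open>p\<close> and \<open>q\<close> of the two projections
  (\<open>trace_projections\<close>). What is left after subtracting \<open>n J'(0, 1) = n (n - Z)\<close> is the asserted formula.

  The subspaces \<open>\<H>\<close> and \<open>\<V>\<close> are given as eigenspaces of a curvature operator, and the computation needs
  them to be the orthogonal complement of the \<open>\<K>\<close>-line through \<open>\<theta>\<close> and the part of that line orthogonal
  to \<open>\<theta>\<close>. Two properties common to the three geometries suffice for this: \<open>|z|\<^sup>2\<close> times the projection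
  \<open>P\<^sub>z\<close> onto the line through \<open>z\<close> is quadratic in \<open>z\<close>, and \<open>|z|\<^sup>2 |P\<^sub>z u|\<^sup>2\<close> is symmetric in \<open>z\<close> and \<open>u\<close>.
  The locale \<open>line_field\<close> records them; the second-order Taylor expansion of the metric then gives
  \<open>R(X,\<theta>)\<theta> = - X - 3 P\<^sub>\<theta> X\<close> for \<open>X\<close> orthogonal to the unit vector \<open>\<theta>\<close> (\<open>curvature_at_centre\<close>). For the
  complex and quaternionic lines the two properties come from orthogonal complex structures, for the
  octonionic ones from the alternative law and the fact that multiplication by the conjugate is adjoint to
  multiplication.\<close>

section \<open>Rank-one updates and orthogonal projections\<close>

lemma outer_product_mult_vec:
  fixes u v z :: "real^'n::finite"
  shows "(\<chi> i j. u $ i * v $ j) *v z = (v \<bullet> z) *\<^sub>R u"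
  by (simp add: matrix_vector_mult_def vec_eq_iff inner_vec_def sum_distrib_left mult_ac)

lemma outer_product_sum_mult_vec:
  fixes z :: "real^'n::finite"
  shows "(\<chi> i j. c * (\<Sum>b\<in>B. b $ i * b $ j)) *v z = c *\<^sub>R (\<Sum>b\<in>B. (b \<bullet> z) *\<^sub>R b)"
proof -
  have "(\<Sum>j\<in>UNIV. c * (\<Sum>b\<in>B. b $ i * b $ j) * z $ j) = c * (\<Sum>b\<in>B. (b \<bullet> z) * b $ i)" for i
  proof -
    have "(\<Sum>j\<in>UNIV. c * (\<Sum>b\<in>B. b $ i * b $ j) * z $ j) = (\<Sum>j\<in>UNIV. \<Sum>b\<in>B. c * (b $ i * b $ j) * z $ j)"
      by (simp add: sum_distrib_left sum_distrib_right)
    also have "\<dots> = (\<Sum>b\<in>B. \<Sum>j\<in>UNIV. c * (b $ i * b $ j) * z $ j)" by (rule sum.swap)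
    also have "\<dots> = (\<Sum>b\<in>B. \<Sum>j\<in>UNIV. c * (b $ j * z $ j * b $ i))" by (simp add: mult_ac)
    also have "\<dots> = c * (\<Sum>b\<in>B. (b \<bullet> z) * b $ i)"
      by (simp only: inner_vec_def inner_real_def sum_distrib_left sum_distrib_right)
    finally show ?thesis .
  qed
  thus ?thesis by (simp add: matrix_vector_mult_def vec_eq_iff sum_component)
qed

text \<open>A rotation takes \<open>u\<close> to a multiple of a coordinate vector; then only one row of the identity matrix
  is changed, and Cramer's rule evaluates the determinant.\<close>
lemma det_rank_one_update:
  fixes u v :: "real^'n::finite"
  shows "det (mat 1 + (\<chi> i j. u $ i * v $ j)) = 1 + u \<bullet> v"
proof (cases "u = 0")
  case True
  hence "(\<chi> i j. u $ i * v $ j) = (0 :: real^'n^'n)" by (simp add: vec_eq_iff)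
  thus ?thesis using True by (simp add: det_I)
next
  case False
  \<comment> \<open>any index will do\<close>
  define k :: 'n where "k = undefined"
  define a where "a = u /\<^sub>R norm u"
  have "norm (axis k (1::real)) = 1" "norm a = 1" using False by (simp_all add: a_def)
  then obtain f :: "real^'n \<Rightarrow> real^'n" where f: "orthogonal_transformation f" "f (axis k 1) = a"
    by (rule orthogonal_transformation_exists_1)
  define M where "M = matrix f"
  have M: "orthogonal_matrix M" and lf: "linear f"
    using f(1) by (simp_all add: orthogonal_transformation_matrix M_def)
  have Mt: "transpose M ** M = mat 1" "M ** transpose M = mat 1"
    using M by (simp_all add: orthogonal_matrix_def)
  have MMt: "M *v (transpose M *v z) = z" for z
    by (simp only: matrix_vector_mul_assoc Mt matrix_vector_mul_lid)
  have adj: "(transpose M *v a) \<bullet> b = a \<bullet> (M *v b)" for a b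
    by (simp add: dot_lmul_matrix)
  have u: "u = norm u *\<^sub>R (M *v axis k 1)"
    using f(2) False lf by (simp add: M_def matrix_works a_def)
  define w where "w = norm u *\<^sub>R (transpose M *v v)"
  define K :: "real^'n^'n" where "K = mat 1 + (\<chi> i j. axis k 1 $ i * w $ j)"
  have "K = (\<chi> i. if i = k then sum (\<lambda>i. (axis k 1 + w) $ i *s row i (mat 1 :: real^'n^'n)) UNIV
               else row i (mat 1))"
    by (auto simp: K_def vec_eq_iff row_def mat_def axis_def sum_component sum.distrib distrib_right
        if_distrib[of "\<lambda>x. _ * x"] if_distrib[of "\<lambda>x. x * _"] cong: if_cong)
  hence "det K = (axis k 1 + w) $ k * det (mat 1 :: real^'n^'n)"
    by (simp only: cramer_lemma_transpose)
  hence K: "det K = 1 + w $ k" by (simp add: det_I axis_def)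
  have "M ** K ** transpose M = mat 1 + (\<chi> i j. u $ i * v $ j)" (is "?l = ?r")
  proof (rule matrix_eq[THEN iffD2], rule allI)
    fix z
    have Kz: "K *v y = y + (w \<bullet> y) *\<^sub>R axis k 1" for y
      by (simp add: K_def matrix_vector_mult_add_rdistrib outer_product_mult_vec outer_product_sum_mult_vec)
    have rz: "?r *v z = z + (v \<bullet> z) *\<^sub>R u"
      by (simp add: matrix_vector_mult_add_rdistrib outer_product_mult_vec outer_product_sum_mult_vec)
    have "?l *v z = M *v (K *v (transpose M *v z))"
      by (simp only: matrix_vector_mul_assoc matrix_mul_assoc)
    also have "\<dots> = z + (w \<bullet> (transpose M *v z)) *\<^sub>R (M *v axis k 1)"
      by (simp only: Kz matrix_vector_right_distrib matrix_vector_mult_scaleR MMt)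
    also have "w \<bullet> (transpose M *v z) = norm u * (v \<bullet> z)"
      by (simp only: w_def inner_scaleR_left adj MMt)
    finally have "?l *v z = z + (v \<bullet> z) *\<^sub>R (norm u *\<^sub>R (M *v axis k 1))" by (simp add: mult.commute)
    thus "?l *v z = ?r *v z" by (simp only: rz u[symmetric])
  qed
  hence "det (mat 1 + (\<chi> i j. u $ i * v $ j)) = det M * det K * det (transpose M)"
    by (metis det_mul)
  also have "\<dots> = det K * det (M ** transpose M)" by (simp add: det_mul mult_ac)
  also have "\<dots> = 1 + w $ k" by (simp add: Mt K det_I)
  also have "w $ k = w \<bullet> axis k 1" by (simp add: inner_axis)
  also have "\<dots> = (norm u *\<^sub>R (M *v axis k 1)) \<bullet> v"
    by (simp only: w_def inner_scaleR_left adj inner_commute[of v])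
  also have "\<dots> = u \<bullet> v" by (simp only: u[symmetric])
  finally show ?thesis .
qed

text \<open>For orthonormal vectors the matrix is a product of rank-one updates, since each vector is fixed by the
  updates along the others. This gives the determinant of a metric that scales a subspace.\<close>
lemma det_projection_update:
  fixes B :: "(real^'n::finite) set"
  assumes "finite B" "pairwise orthogonal B" "\<forall>b\<in>B. norm b = 1"
  shows "det (mat 1 + (\<chi> i j. c * (\<Sum>b\<in>B. b $ i * b $ j))) = (1 + c) ^ card B"
  using assms
proof (induction B rule: finite_induct)
  case empty
  have "(\<chi> i j. 0) = (0 :: real^'n^'n)" by (simp add: vec_eq_iff)
  thus ?case by (simp add: det_I)
next
  case (insert a B)
  define K :: "real^'n^'n" where "K = mat 1 + (\<chi> i j. c * (\<Sum>b\<in>B. b $ i * b $ j))"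
  have K: "K *v z = z + c *\<^sub>R (\<Sum>b\<in>B. (b \<bullet> z) *\<^sub>R b)" for z
    by (simp add: K_def matrix_vector_mult_add_rdistrib outer_product_mult_vec outer_product_sum_mult_vec)
  have "b \<bullet> a = 0" if "b \<in> B" for b
    using insert.prems(1) insert.hyps(2) that by (auto simp: pairwise_def orthogonal_def)
  hence Ka: "K *v a = a" by (simp add: K)
  define R :: "real^'n^'n" where "R = mat 1 + (\<chi> i j. (c *\<^sub>R a) $ i * a $ j)"
  have R: "R *v z = z + (c * (a \<bullet> z)) *\<^sub>R a" for z
    unfolding R_def matrix_vector_mult_add_rdistrib outer_product_mult_vec
    by (simp add: mult.commute)
  have "mat 1 + (\<chi> i j. c * (\<Sum>b\<in>insert a B. b $ i * b $ j)) = K ** R" (is "?l = _")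
  proof (rule matrix_eq[THEN iffD2], rule allI)
    fix z
    have "?l = K + (\<chi> i j. (c *\<^sub>R a) $ i * a $ j)"
      using insert.hyps by (simp add: K_def vec_eq_iff algebra_simps)
    hence "?l *v z = K *v z + (c * (a \<bullet> z)) *\<^sub>R a"
      apply (simp only:) unfolding matrix_vector_mult_add_rdistrib outer_product_mult_vec by (simp add: mult.commute)
    also have "\<dots> = K *v (R *v z)"
      by (simp add: R matrix_vector_right_distrib matrix_vector_mult_scaleR Ka)
    finally show "?l *v z = (K ** R) *v z" by (simp add: matrix_vector_mul_assoc)
  qed
  moreover have "det K = (1 + c) ^ card B"
    unfolding K_def using insert.prems by (intro insert.IH) (auto simp: pairwise_insert)
  moreover have "det R = 1 + c"
    unfolding R_def det_rank_one_update using insert.prems by (simp add: norm_eq_1)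
  ultimately show ?case using insert.hyps by (simp add: det_mul)
qed

lemma closest_point_subspace_eqI:
  fixes S :: "(real^'n::finite) set"
  assumes S: "subspace S" and y: "y \<in> S" and o: "\<And>k. k \<in> S \<Longrightarrow> (x - y) \<bullet> k = 0"
  shows "closest_point S x = y"
proof (rule closest_point_unique[symmetric])
  show "convex S" "closed S" using S by (auto simp: subspace_imp_convex closed_subspace)
  show "\<forall>z\<in>S. dist x y \<le> dist x z"
  proof
    fix z assume z: "z \<in> S"
    have "orthogonal (x - y) (y - z)"
      using o[OF subspace_diff[OF S y z]] by (simp add: orthogonal_def)
    hence "(norm ((x - y) + (y - z)))\<^sup>2 = (norm (x - y))\<^sup>2 + (norm (y - z))\<^sup>2"
      by (rule norm_add_Pythagorean)
    hence "(norm (x - y))\<^sup>2 \<le> (norm (x - z))\<^sup>2" by simp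
    thus "dist x y \<le> dist x z" unfolding dist_norm by (rule power2_le_imp_le) simp
  qed
qed (rule y)

lemma closest_point_subspace:
  fixes S :: "(real^'n::finite) set"
  assumes S: "subspace S"
  shows "closest_point S x \<in> S" "k \<in> S \<Longrightarrow> (x - closest_point S x) \<bullet> k = 0"
proof -
  obtain y z where yz: "y \<in> span S" "\<And>w. w \<in> span S \<Longrightarrow> orthogonal z w" "x = y + z"
    using orthogonal_subspace_decomp_exists[of S x] by metis
  hence "closest_point S x = y"
    using S by (intro closest_point_subspace_eqI) (auto simp: orthogonal_def span_eq_iff[THEN iffD2])
  thus "closest_point S x \<in> S" "k \<in> S \<Longrightarrow> (x - closest_point S x) \<bullet> k = 0"
    using yz S by (auto simp: orthogonal_def span_eq_iff[THEN iffD2])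
qed

lemma linear_closest_point_subspace:
  fixes S :: "(real^'n::finite) set"
  assumes S: "subspace S"
  shows "linear (closest_point S)"
proof (rule linearI)
  note m = closest_point_subspace(1)[OF S] and o = closest_point_subspace(2)[OF S]
  show "closest_point S (x + y) = closest_point S x + closest_point S y" for x y
  proof (rule closest_point_subspace_eqI[OF S subspace_add[OF S m m]])
    fix k assume k: "k \<in> S"
    have "(x + y - (closest_point S x + closest_point S y)) \<bullet> k
        = (x - closest_point S x) \<bullet> k + (y - closest_point S y) \<bullet> k"
      by (simp add: inner_diff_left inner_add_left)
    thus "(x + y - (closest_point S x + closest_point S y)) \<bullet> k = 0"
      by (simp add: o[OF k])
  qed
  show "closest_point S (c *\<^sub>R x) = c *\<^sub>R closest_point S x" for c x
  proof (rule closest_point_subspace_eqI[OF S subspace_mul[OF S m]])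
    fix k assume k: "k \<in> S"
    have "(c *\<^sub>R x - c *\<^sub>R closest_point S x) \<bullet> k = c * ((x - closest_point S x) \<bullet> k)"
      by (simp add: inner_diff_left right_diff_distrib)
    thus "(c *\<^sub>R x - c *\<^sub>R closest_point S x) \<bullet> k = 0"
      by (simp add: o[OF k])
  qed
qed

lemma closest_point_subspace_inner:
  fixes S :: "(real^'n::finite) set"
  assumes S: "subspace S"
  shows "closest_point S x \<bullet> closest_point S y = closest_point S x \<bullet> y"
  using closest_point_subspace(2)[OF S closest_point_subspace(1)[OF S], of y x]
  by (simp add: inner_diff_left inner_commute[of _ "closest_point S x"] inner_diff_right)

lemma matrix_inv_mult_vec_eqI:
  fixes A :: "real^'n^'n::finite"
  assumes "invertible A" "A *v x = b"
  shows "matrix_inv A *v b = x"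
proof -
  have "matrix_inv A ** A = mat 1"
    using assms(1) someI_ex[of "\<lambda>A'. A ** A' = mat 1 \<and> A' ** A = mat 1"]
    by (simp add: invertible_def matrix_inv_def)
  thus ?thesis using assms(2) by (auto simp: matrix_vector_mul_assoc)
qed

lemma invertible_if_inj_mult_vec:
  fixes A :: "real^'n^'n::finite"
  assumes "\<And>x. A *v x = 0 \<Longrightarrow> x = 0"
  shows "invertible A"
  using assms invertible_left_inverse[of A] matrix_left_invertible_ker[of A] by blast

lemma numeral_mult_vec: "numeral k * (x :: real^'n) = numeral k *\<^sub>R x"
  by (simp add: vec_eq_iff)

section \<open>The volume radius and the radial profiles\<close>

lemma le_sinh: "0 \<le> x \<Longrightarrow> x \<le> sinh (x::real)"
proof -
  assume x: "0 \<le> x"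
  have "sinh 0 - 0 \<le> sinh x - x"
  proof (rule DERIV_nonneg_imp_nondecreasing[OF x])
    fix s :: real
    have "((\<lambda>s. sinh s - s) has_real_derivative cosh s - 1) (at s)"
      by (auto intro!: derivative_eq_intros)
    thus "\<exists>d. ((\<lambda>s. sinh s - s) has_real_derivative d) (at s) \<and> 0 \<le> d"
      using cosh_real_ge_1[of s] by auto
  qed
  thus ?thesis by simp
qed

text \<open>Up to the area of the unit sphere (divided by \<open>n\<close> in the case of the ball), \<open>ball_volume_fun\<close> and
  \<open>sphere_area_fun\<close> are the volume of a geodesic ball of radius \<open>r\<close> and the area of its boundary.\<close>
definition ball_volume_fun :: "nat \<Rightarrow> nat \<Rightarrow> real \<Rightarrow> real" where
  "ball_volume_fun n q r = real n * integral {0..r} (\<lambda>s. sinh s ^ (n - 1) * cosh s ^ q)"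

definition sphere_area_fun :: "nat \<Rightarrow> nat \<Rightarrow> real \<Rightarrow> real" where
  "sphere_area_fun n q r = sinh r ^ (n - 1) * cosh r ^ q"

lemma sphere_area_fun_pos: "0 < r \<Longrightarrow> 0 < sphere_area_fun n q r"
  by (simp add: sphere_area_fun_def)

lemma continuous_on_sphere_area_fun: "continuous_on X (sphere_area_fun n q)"
  unfolding sphere_area_fun_def by (intro continuous_intros)

lemma continuous_on_ball_volume_fun: "continuous_on {0..b} (ball_volume_fun n q)"
  unfolding ball_volume_fun_def sphere_area_fun_def[symmetric]
  by (intro continuous_intros indefinite_integral_continuous_1 integrable_continuous_interval
        continuous_on_sphere_area_fun)

lemma ball_volume_fun_deriv:
  assumes "0 < r"
  shows "(ball_volume_fun n q has_real_derivative real n * sphere_area_fun n q r) (at r)"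
proof -
  have "((\<lambda>r. integral {0..r} (sphere_area_fun n q)) has_real_derivative sphere_area_fun n q r)
          (at r within {0..r + 1})"
    by (rule integral_has_real_derivative) (use assms in \<open>auto intro: continuous_on_sphere_area_fun\<close>)
  hence "((\<lambda>r. integral {0..r} (sphere_area_fun n q)) has_real_derivative sphere_area_fun n q r) (at r)"
    using assms by (simp add: at_within_Icc_at)
  thus ?thesis
    unfolding ball_volume_fun_def sphere_area_fun_def[symmetric] by (rule DERIV_cmult)
qed

text \<open>Comparison with Euclidean space, used for the surjectivity of \<open>log_radius\<close>.\<close>
lemma ball_volume_fun_ge:
  assumes n: "n \<ge> 1" and r: "0 \<le> r"
  shows "r ^ n \<le> ball_volume_fun n q r"
proof -
  have "((\<lambda>s. s ^ (n - 1)) has_integral (r ^ n / n - 0 ^ n / n)) {0..r}"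
  proof (rule fundamental_theorem_of_calculus[OF r])
    fix s assume "s \<in> {0..r}"
    show "((\<lambda>s. s ^ n / n) has_vector_derivative s ^ (n - 1)) (at s within {0..r})"
      unfolding has_real_derivative_iff_has_vector_derivative[symmetric]
      using n by (auto intro!: derivative_eq_intros)
  qed
  moreover have "(sphere_area_fun n q has_integral integral {0..r} (sphere_area_fun n q)) {0..r}"
    by (intro integrable_integral integrable_continuous_interval continuous_on_sphere_area_fun)
  moreover have "s ^ (n - 1) \<le> sphere_area_fun n q s" if "s \<in> {0..r}" for s
    using that mult_mono[OF power_mono[OF le_sinh[of s], of "n - 1"] one_le_power[OF cosh_real_ge_1, of s q]]
    by (simp add: sphere_area_fun_def)
  ultimately have "r ^ n / n - 0 ^ n / n \<le> integral {0..r} (sphere_area_fun n q)"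
    by (rule has_integral_le)
  thus ?thesis
    using n unfolding ball_volume_fun_def sphere_area_fun_def[symmetric] by (simp add: field_simps zero_power)
qed

lemma exp_log_radius:
  assumes n: "n \<ge> 1" and r: "0 < r"
  shows "exp (real n * log_radius n q r) = ball_volume_fun n q r"
proof -
  have "0 < r ^ n" using r by simp
  hence "0 < ball_volume_fun n q r"
    using ball_volume_fun_ge[of n r q] n r by linarith
  thus ?thesis using n
    by (simp add: log_radius_def vol_radius_def ln_root flip: ball_volume_fun_def del: One_nat_def)
qed

lemma log_radius_deriv:
  assumes n: "n \<ge> 1" and r: "0 < r"
  shows "(log_radius n q has_real_derivative
           sphere_area_fun n q r / exp (real n * log_radius n q r)) (at r)"
proof -
  have V: "0 < ball_volume_fun n q r"
    using exp_log_radius[OF n r, of q] by (metis exp_gt_zero)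
  have "((\<lambda>r. ln (ball_volume_fun n q r) / n) has_real_derivative
          sphere_area_fun n q r / ball_volume_fun n q r) (at r)"
    using ball_volume_fun_deriv[OF r, of n q] V n
    by (auto intro!: derivative_eq_intros)
  moreover have "ln (ball_volume_fun n q s) / n = log_radius n q s" if "s \<in> {0<..}" for s
    using exp_log_radius[OF n, of s q] that n by (metis greaterThan_iff ln_exp nonzero_mult_div_cancel_left
        of_nat_0_eq_iff not_one_le_zero)
  ultimately show ?thesis
    unfolding exp_log_radius[OF n r]
    using r by (auto elim!: has_field_derivative_transform_within_open[where S = "{0<..}"])
qed

lemma log_radius_less:
  assumes n: "n \<ge> 1" and r: "0 < r" "r < s"
  shows "log_radius n q r < log_radius n q s"
proof (rule DERIV_pos_imp_increasing[OF r(2)])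
  fix u assume "r \<le> u"
  hence u: "0 < u" using r by simp
  show "\<exists>d. (log_radius n q has_real_derivative d) (at u) \<and> 0 < d"
    using log_radius_deriv[OF n u, of q] sphere_area_fun_pos[OF u, of n q] by (auto intro!: exI)
qed

text \<open>Existence is the intermediate value theorem on \<open>{0..exp y}\<close>: the upper end is large enough by the
  Euclidean comparison. Hence \<open>r_of\<close> is a global inverse, defined for every real \<open>y\<close>.\<close>
lemma r_of_unique:
  assumes n: "n \<ge> 1"
  shows "\<exists>!r. 0 < r \<and> log_radius n q r = y"
proof -
  have "\<exists>r. 0 \<le> r \<and> r \<le> exp y \<and> ball_volume_fun n q r = exp (real n * y)"
  proof (rule IVT')
    show "ball_volume_fun n q 0 \<le> exp (real n * y)" by (simp add: ball_volume_fun_def)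
    show "exp (real n * y) \<le> ball_volume_fun n q (exp y)"
      using ball_volume_fun_ge[OF n, of "exp y" q] by (simp add: exp_of_nat_mult)
  qed (auto intro: continuous_on_ball_volume_fun)
  then obtain r where r: "0 \<le> r" "ball_volume_fun n q r = exp (real n * y)" by blast
  have "r \<noteq> 0" using r(2) by (metis ball_volume_fun_def exp_not_eq_zero integral_refl mult_zero_right cbox_interval)
  hence "0 < r" using r by simp
  moreover have "log_radius n q r = y"
    using exp_log_radius[OF n \<open>0 < r\<close>, of q] r(2) n by simp
  ultimately show ?thesis
    using log_radius_less[OF n] by (intro ex1I[of _ r]) (auto, metis linorder_neqE_linordered_idom less_irrefl)
qed

lemma r_of_pos: "n \<ge> 1 \<Longrightarrow> 0 < r_of n q y"
  and log_radius_r_of: "n \<ge> 1 \<Longrightarrow> log_radius n q (r_of n q y) = y"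
  using theI'[OF r_of_unique, of n q y] by (auto simp: r_of_def)

lemma r_of_log_radius: "n \<ge> 1 \<Longrightarrow> 0 < r \<Longrightarrow> r_of n q (log_radius n q r) = r"
  using r_of_unique[of n q "log_radius n q r"] r_of_pos log_radius_r_of by metis

lemma r_of_deriv':
  assumes n: "n \<ge> 1"
  shows "(r_of n q has_real_derivative exp (real n * y) / sphere_area_fun n q (r_of n q y)) (at y)"
proof -
  define r where "r = r_of n q y"
  have r: "0 < r" "log_radius n q r = y" using n by (simp_all add: r_def r_of_pos log_radius_r_of)
  have nz: "sphere_area_fun n q r / exp (real n * log_radius n q r) \<noteq> 0"
    using sphere_area_fun_pos[OF r(1), of n q] by simp
  have "(r_of n q has_derivative (*) (inverse (sphere_area_fun n q r / exp (real n * log_radius n q r))))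
          (at (log_radius n q r))"
  proof (rule has_derivative_inverse_strong[where S = "{0<..}" and f = "log_radius n q" and x = r
        and f' = "(*) (sphere_area_fun n q r / exp (real n * log_radius n q r))"])
    show "(log_radius n q has_derivative (*) (sphere_area_fun n q r / exp (real n * log_radius n q r))) (at r)"
      using log_radius_deriv[OF n r(1)] by (simp add: has_field_derivative_def)
    show "continuous_on {0<..} (log_radius n q)"
      by (rule DERIV_continuous_on, rule has_field_derivative_at_within, rule log_radius_deriv[OF n])
         simp
    show "(*) (sphere_area_fun n q r / exp (real n * log_radius n q r)) \<circ>
            (*) (inverse (sphere_area_fun n q r / exp (real n * log_radius n q r))) = id"
      using nz by (simp add: fun_eq_iff)
    show "r_of n q (log_radius n q s) = s" if "s \<in> {0<..}" for s
      using that n by (simp add: r_of_log_radius)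
  qed (use r in auto)
  thus ?thesis using r by (simp add: r_def has_field_derivative_def)
qed

lemma a_fun_eq:
  "n \<ge> 1 \<Longrightarrow> a_fun n q y = exp (real n * y) / sphere_area_fun n q (r_of n q y)"
  unfolding a_fun_def by (rule DERIV_imp_deriv[OF r_of_deriv'])

lemma r_of_deriv: "n \<ge> 1 \<Longrightarrow> (r_of n q has_real_derivative a_fun n q y) (at y)"
  using r_of_deriv' by (simp add: a_fun_eq)

lemma a_fun_pos: "n \<ge> 1 \<Longrightarrow> 0 < a_fun n q y"
  by (simp add: a_fun_eq sphere_area_fun_pos r_of_pos)

lemma log_radius_deriv_a_fun:
  assumes "n \<ge> 1" "0 < r"
  shows "(log_radius n q has_real_derivative 1 / a_fun n q (log_radius n q r)) (at r)"
  using log_radius_deriv[OF assms, of q] assms by (simp add: a_fun_eq r_of_log_radius)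

text \<open>The volume radius is chosen so that the Riemannian volume in the coordinates \<open>(y, \<theta>)\<close> has the
  Euclidean density \<open>exp (n y)\<close>.\<close>
lemma volume_density:
  "n = p + q + 1 \<Longrightarrow> a_fun n q y * b_fun n q y ^ p * c_fun n q y ^ q = exp (real n * y)"
  using r_of_pos[of n q y]
  by (simp add: a_fun_eq b_fun_def c_fun_def sphere_area_fun_def power_add power_mult_distrib)

definition twice_differentiable :: "(real \<Rightarrow> real) \<Rightarrow> bool" where
  "twice_differentiable f \<longleftrightarrow> (\<forall>s. (f has_real_derivative deriv f s) (at s)) \<and>
     (\<forall>s. (deriv f has_real_derivative (deriv ^^ 2) f s) (at s))"

lemma twice_differentiableI:
  assumes "\<And>s. (f has_real_derivative f' s) (at s)"
    and "\<And>s. (f' has_real_derivative f'' s) (at s)"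
  shows "twice_differentiable f"
proof -
  have "deriv f = f'" "deriv f' = f''" using assms by (auto intro: DERIV_imp_deriv)
  thus ?thesis using assms by (simp add: twice_differentiable_def numeral_2_eq_2)
qed

text \<open>The logarithmic derivative of \<open>sinh\<^sup>k cosh\<^sup>l\<close>. All three profiles are, up to sign and a linear term,
  logarithms of such products composed with \<open>r_of\<close>.\<close>
definition log_slope :: "nat \<Rightarrow> nat \<Rightarrow> real \<Rightarrow> real" where
  "log_slope k l r = real k * cosh r / sinh r + real l * sinh r / cosh r"

lemma ln_sinh_cosh_deriv:
  assumes "0 < r"
  shows "((\<lambda>r. ln (sinh r ^ k * cosh r ^ l)) has_real_derivative log_slope k l r) (at r)"
proof -
  have r: "sinh r > 0" "cosh r > 0" using assms by simp_all
  have "((\<lambda>r. real k * ln (sinh r) + real l * ln (cosh r)) has_real_derivative log_slope k l r) (at r)"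
    using r unfolding log_slope_def by (auto intro!: derivative_eq_intros simp: mult.commute)
  moreover have "real k * ln (sinh s) + real l * ln (cosh s) = ln (sinh s ^ k * cosh s ^ l)"
    if "s \<in> {0<..}" for s :: real
    using that by (simp add: ln_mult ln_realpow)
  ultimately show ?thesis
    using assms by (auto elim!: has_field_derivative_transform_within_open[where S = "{0<..}"])
qed

lemma log_slope_deriv:
  assumes "0 < r"
  shows "(log_slope k l has_real_derivative
           real k * (1 - (cosh r / sinh r)\<^sup>2) + real l * (1 - (sinh r / cosh r)\<^sup>2)) (at r)"
proof -
  have r: "sinh r > 0" "cosh r > 0" using assms by simp_all
  have 1: "((\<lambda>r. cosh r / sinh r) has_real_derivative 1 - (cosh r / sinh r)\<^sup>2) (at r)"
    using r by (auto intro!: derivative_eq_intros simp: field_simps power2_eq_square)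
  have 2: "((\<lambda>r. sinh r / cosh r) has_real_derivative 1 - (sinh r / cosh r)\<^sup>2) (at r)"
    using r by (auto intro!: derivative_eq_intros simp: field_simps power2_eq_square)
  show ?thesis
    using DERIV_add[OF DERIV_cmult[OF 1, of "real k"] DERIV_cmult[OF 2, of "real l"]]
    by (simp add: log_slope_def[abs_def])
qed

lemma ln_profile_deriv:
  assumes n: "n \<ge> 1"
  shows "((\<lambda>s. ln (sinh (r_of n q s) ^ k * cosh (r_of n q s) ^ l)) has_real_derivative
           log_slope k l (r_of n q s) * a_fun n q s) (at s)"
  using DERIV_chain2[OF ln_sinh_cosh_deriv[OF r_of_pos[OF n]] r_of_deriv[OF n]] .

lemma ln_a_fun_deriv:
  assumes n: "n \<ge> 1"
  shows "((\<lambda>s. ln (a_fun n q s)) has_real_derivative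
           real n - log_slope (n - 1) q (r_of n q s) * a_fun n q s) (at s)"
proof -
  have "(\<lambda>s. ln (a_fun n q s)) = (\<lambda>s. real n * s - ln (sinh (r_of n q s) ^ (n - 1) * cosh (r_of n q s) ^ q))"
    using sphere_area_fun_pos[OF r_of_pos[OF n, of q], of n q]
    unfolding sphere_area_fun_def[symmetric]
    by (simp add: a_fun_eq[OF n] ln_div less_imp_neq[symmetric] fun_eq_iff)
  moreover have "((\<lambda>s. real n * s) has_real_derivative real n) (at s)"
    by (auto intro!: derivative_eq_intros)
  ultimately show ?thesis using DERIV_diff[OF _ ln_profile_deriv[OF n]] by simp
qed

lemma a_fun_deriv:
  assumes n: "n \<ge> 1"
  shows "(a_fun n q has_real_derivative
           (real n - log_slope (n - 1) q (r_of n q s) * a_fun n q s) * a_fun n q s) (at s)"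
proof -
  have "((\<lambda>s. exp (ln (a_fun n q s))) has_real_derivative
           exp (ln (a_fun n q s)) * (real n - log_slope (n - 1) q (r_of n q s) * a_fun n q s)) (at s)"
    by (rule DERIV_fun_exp[OF ln_a_fun_deriv[OF n]])
  thus ?thesis using a_fun_pos[OF n, of q] by (simp add: mult.commute)
qed

lemma log_slope_a_fun_deriv:
  assumes n: "n \<ge> 1"
  obtains D where "\<And>s. ((\<lambda>s. log_slope k l (r_of n q s) * a_fun n q s) has_real_derivative D s) (at s)"
proof (rule that)
  show "((\<lambda>s. log_slope k l (r_of n q s) * a_fun n q s) has_real_derivative
      (real k * (1 - (cosh (r_of n q s) / sinh (r_of n q s))\<^sup>2)
        + real l * (1 - (sinh (r_of n q s) / cosh (r_of n q s))\<^sup>2)) * a_fun n q s * a_fun n q s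
      + (real n - log_slope (n - 1) q (r_of n q s) * a_fun n q s) * a_fun n q s
        * log_slope k l (r_of n q s)) (at s)" for s
    by (rule DERIV_mult[OF DERIV_chain2[OF log_slope_deriv[OF r_of_pos[OF n]] r_of_deriv[OF n]] a_fun_deriv[OF n]])
qed

text \<open>\<open>r_of\<close> solves the differential equation \<open>r' = a\<close> with \<open>a\<close> a smooth function of \<open>(y, r)\<close>, so every
  derivative of a profile is again an elementary expression in \<open>r_of\<close> and \<open>a_fun\<close>.\<close>
lemma radial_profiles_twice_differentiable:
  assumes n: "n \<ge> 1"
  shows "twice_differentiable (\<lambda>s. ln (a_fun n q s))"
    and "twice_differentiable (\<lambda>s. ln (b_fun n q s))"
    and "twice_differentiable (\<lambda>s. ln (c_fun n q s))"
proof -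
  obtain D where D: "\<And>s. ((\<lambda>s. log_slope (n - 1) q (r_of n q s) * a_fun n q s) has_real_derivative D s) (at s)"
    using log_slope_a_fun_deriv[OF n] by blast
  have "((\<lambda>s. real n - log_slope (n - 1) q (r_of n q s) * a_fun n q s) has_real_derivative 0 - D s) (at s)" for s
    by (rule DERIV_diff[OF DERIV_const D])
  with ln_a_fun_deriv[OF n] show "twice_differentiable (\<lambda>s. ln (a_fun n q s))"
    by (rule twice_differentiableI)
  have P: "twice_differentiable (\<lambda>s. ln (sinh (r_of n q s) ^ k * cosh (r_of n q s) ^ l))" for k l
  proof -
    obtain D where "\<And>s. ((\<lambda>s. log_slope k l (r_of n q s) * a_fun n q s) has_real_derivative D s) (at s)"
      using log_slope_a_fun_deriv[OF n] by blast
    with ln_profile_deriv[OF n] show ?thesis by (rule twice_differentiableI)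
  qed
  show "twice_differentiable (\<lambda>s. ln (b_fun n q s))" using P[of 1 0] by (simp add: b_fun_def)
  show "twice_differentiable (\<lambda>s. ln (c_fun n q s))" using P[of 1 1] by (simp add: c_fun_def)
qed

section \<open>Metrics built from a field of lines and their curvature at the centre\<close>

text \<open>\<open>T\<close> is the polarization of the quadratic map \<open>z \<mapsto> |z|\<^sup>2 P\<^sub>z\<close>, and reciprocity says that
  \<open>|z|\<^sup>2 |P\<^sub>z u|\<^sup>2\<close> is symmetric in \<open>z\<close> and \<open>u\<close>. The number \<open>q\<close> is the dimension of the imaginary part of
  the algebra.\<close>
locale line_field =
  fixes L :: "real^'n::finite \<Rightarrow> (real^'n) set"
    and T :: "real^'n \<Rightarrow> real^'n \<Rightarrow> real^'n \<Rightarrow> real^'n"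
    and q :: nat
  assumes subspace_L: "subspace (L z)"
    and mem_L: "z \<in> L z"
    and L_scaleR: "c \<noteq> 0 \<Longrightarrow> L (c *\<^sub>R z) = L z"
    and dim_L: "z \<noteq> 0 \<Longrightarrow> dim (L z) = q + 1"
    and T_linear: "linear (T a b)"
    and T_linear_left: "linear (\<lambda>a. T a b u)"
    and T_commute: "T a b u = T b a u"
    and T_diag: "T z z u = (norm z)\<^sup>2 *\<^sub>R closest_point (L z) u"
    and T_reciprocal: "T z z u \<bullet> u = T u u z \<bullet> z"
begin

abbreviation P where "P z \<equiv> closest_point (L z)"
abbreviation g where "g \<equiv> ball_metric L"

lemmas linear_P = linear_closest_point_subspace[OF subspace_L]
lemmas P_inner = closest_point_subspace_inner[OF subspace_L]
lemmas P_mem = closest_point_subspace(1)[OF subspace_L]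
lemmas P_self = closest_point_self

lemma P_inner_commute: "P z u \<bullet> v = u \<bullet> P z v"
  by (metis P_inner inner_commute)

lemma P_idem: "P z (P z u) = P z u"
  by (simp add: P_self P_mem)

lemmas T_simps = linear_add[OF T_linear] linear_diff[OF T_linear] linear_cmul[OF T_linear] linear_neg[OF T_linear]
  linear_0[OF T_linear]

lemma T_add_left: "T (a + c) b u = T a b u + T c b u"
  and T_diff_left: "T (a - c) b u = T a b u - T c b u"
  and T_scaleR_left: "T (r *\<^sub>R a) b u = r *\<^sub>R T a b u"
  using T_linear_left by (simp_all add: linear_add[OF T_linear_left] linear_diff[OF T_linear_left] linear_cmul[OF T_linear_left])

lemma T_add_right: "T b (a + c) u = T b a u + T b c u"
  and T_diff_right: "T b (a - c) u = T b a u - T b c u"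
  and T_scaleR_right: "T b (r *\<^sub>R a) u = r *\<^sub>R T b a u"
  using T_add_left T_diff_left T_scaleR_left by (metis T_commute)+

lemma T_diag_symmetric: "T z z u \<bullet> v = u \<bullet> T z z v"
  by (simp add: T_diag P_inner_commute)

lemma T_symmetric: "T a b u \<bullet> v = u \<bullet> T a b v"
proof -
  have "T (a + b) (a + b) u \<bullet> v = u \<bullet> T (a + b) (a + b) v" by (rule T_diag_symmetric)
  thus ?thesis
    using T_diag_symmetric[of a u v] T_diag_symmetric[of b u v]
    unfolding T_add_left T_add_right inner_add_left inner_add_right T_commute[of b a] by linarith
qed

lemma T_self: "T z z z = (norm z)\<^sup>2 *\<^sub>R z"
  by (simp add: T_diag P_self mem_L)

lemma T_square: "T z z (T z z u) = (norm z)\<^sup>2 *\<^sub>R T z z u"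
  by (simp add: T_diag linear_cmul[OF linear_P] P_idem)

text \<open>Polarization of the cubic identity \<open>T z z z = |z|\<^sup>2 z\<close>, which holds because \<open>z\<close> lies on its line: the
  part linear in \<open>k\<close> is isolated by the odd part of \<open>z = a \<plusminus> k\<close>.\<close>
lemma T_self_polarized:
  "T a a k + 2 *\<^sub>R T a k a = (2 * (a \<bullet> k)) *\<^sub>R a + (norm a)\<^sup>2 *\<^sub>R k"
proof -
  have p: "T (a + k) (a + k) (a + k) = (norm (a + k))\<^sup>2 *\<^sub>R (a + k)"
    and m: "T (a - k) (a - k) (a - k) = (norm (a - k))\<^sup>2 *\<^sub>R (a - k)"
    by (rule T_self)+
  have n: "(norm (a + k))\<^sup>2 = (norm a)\<^sup>2 + (norm k)\<^sup>2 + 2 * (a \<bullet> k)"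
    "(norm (a - k))\<^sup>2 = (norm a)\<^sup>2 + (norm k)\<^sup>2 - 2 * (a \<bullet> k)"
    by (simp_all add: power2_norm_eq_inner inner_add_left inner_add_right inner_diff_left
        inner_diff_right inner_commute)
  have "T (a + k) (a + k) (a + k) - T (a - k) (a - k) (a - k)
      = 2 *\<^sub>R (T a a k + 2 *\<^sub>R T a k a) + 2 *\<^sub>R T k k k"
    unfolding T_add_left T_add_right T_diff_left T_diff_right T_simps T_commute[of k a]
    by (simp add: vec_eq_iff)
  moreover have "T (a + k) (a + k) (a + k) - T (a - k) (a - k) (a - k)
      = 2 *\<^sub>R ((2 * (a \<bullet> k)) *\<^sub>R a + (norm a)\<^sup>2 *\<^sub>R k) + 2 *\<^sub>R T k k k"
    unfolding p m n T_self by (simp add: vec_eq_iff algebra_simps)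
  ultimately show ?thesis by simp
qed

lemma T_reciprocal_polarized: "T a b u \<bullet> u = T u u a \<bullet> b"
proof -
  have "T (a + b) (a + b) u \<bullet> u = T u u (a + b) \<bullet> (a + b)" by (rule T_reciprocal)
  thus ?thesis
    using T_reciprocal[of a u] T_reciprocal[of b u] T_symmetric[of u u b a]
    unfolding T_add_left T_add_right T_simps inner_add_left inner_add_right T_commute[of b a]
    by (simp add: inner_commute)
qed

lemma metric_eq:
  "g z u v = (u \<bullet> v) / (1 - (norm z)\<^sup>2) + (T z z u \<bullet> v) / (1 - (norm z)\<^sup>2)\<^sup>2"
  by (simp add: ball_metric_def T_diag P_inner)

text \<open>The self-adjoint operator that represents the metric at \<open>z\<close> with respect to the Euclidean one.\<close>
definition gram_op where
  "gram_op z u = (1 / (1 - (norm z)\<^sup>2)) *\<^sub>R u + (1 / (1 - (norm z)\<^sup>2)\<^sup>2) *\<^sub>R T z z u"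

lemma metric_eq_inner_gram_op: "g z u v = gram_op z u \<bullet> v"
  by (simp add: metric_eq gram_op_def inner_add_left)

lemma linear_gram_op: "linear (gram_op z)"
  unfolding gram_op_def by (rule linearI) (simp_all add: T_simps algebra_simps)

lemma gram_op_symmetric: "gram_op z u \<bullet> v = u \<bullet> gram_op z v"
  by (simp add: gram_op_def inner_add_left inner_add_right T_symmetric)

lemma gram_mult_vec: "gram g z *v u = gram_op z u"
proof -
  have "(gram g z *v u) $ i = gram_op z u $ i" for i
  proof -
    have "(gram g z *v u) $ i = (\<Sum>j\<in>UNIV. g z (axis i 1) (axis j 1) * u $ j)"
      by (simp add: gram_def matrix_vector_mult_def)
    also have "\<dots> = gram_op z (axis i 1) \<bullet> (\<Sum>j\<in>UNIV. u $ j *\<^sub>R axis j 1)"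
      by (simp add: metric_eq_inner_gram_op inner_sum_right mult.commute)
    also have "(\<Sum>j\<in>UNIV. u $ j *\<^sub>R axis j 1) = u"
      by (simp add: vec_eq_iff axis_def if_distrib cong: if_cong)
    also have "gram_op z (axis i 1) \<bullet> u = gram_op z u \<bullet> axis i 1"
      by (metis gram_op_symmetric inner_commute)
    finally show ?thesis by (simp add: inner_axis)
  qed
  thus ?thesis by (simp add: vec_eq_iff)
qed

text \<open>The inverse is polynomial in \<open>z\<close>, because \<open>T z z\<close> is \<open>|z|\<^sup>2\<close> times a projection. This makes the
  Christoffel symbols explicit.\<close>
lemma gram_op_inverse:
  assumes "norm z < 1"
  shows "gram_op z ((1 - (norm z)\<^sup>2) *\<^sub>R (u - T z z u)) = u"
proof -
  define s where "s = (norm z)\<^sup>2"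
  have s: "1 - s \<noteq> 0" using assms by (simp add: s_def power_less_one_iff less_imp_neq abs_square_eq_1)
  have "gram_op z (u - T z z u) = (1 / (1 - s)) *\<^sub>R (u - T z z u) + (1 / (1 - s)\<^sup>2) *\<^sub>R ((1 - s) *\<^sub>R T z z u)"
    by (simp add: gram_op_def T_simps T_square s_def algebra_simps)
  also have "\<dots> = (1 / (1 - s)) *\<^sub>R (u - T z z u) + ((1 / (1 - s)\<^sup>2) * (1 - s)) *\<^sub>R T z z u" by simp
  also have "(1 / (1 - s)\<^sup>2) * (1 - s) = 1 / (1 - s)" using s by (simp add: power2_eq_square)
  also have "(1 / (1 - s)) *\<^sub>R (u - T z z u) + (1 / (1 - s)) *\<^sub>R T z z u = (1 / (1 - s)) *\<^sub>R u"
    by (simp add: scaleR_diff_right)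
  finally show ?thesis using s by (simp add: linear_cmul[OF linear_gram_op] s_def[symmetric])
qed

lemma gram_op_eq_0:
  assumes "norm z < 1" "gram_op z u = 0"
  shows "u = 0"
proof -
  have "gram_op z u \<bullet> ((1 - (norm z)\<^sup>2) *\<^sub>R (u - T z z u)) = u \<bullet> gram_op z ((1 - (norm z)\<^sup>2) *\<^sub>R (u - T z z u))"
    by (rule gram_op_symmetric)
  thus ?thesis using assms(2) by (simp only: gram_op_inverse[OF assms(1)]) simp
qed

lemma invertible_gram: "norm z < 1 \<Longrightarrow> invertible (gram g z)"
  by (rule invertible_if_inj_mult_vec) (simp add: gram_mult_vec gram_op_eq_0)

lemma matrix_inv_gram:
  "norm z < 1 \<Longrightarrow> matrix_inv (gram g z) *v u = (1 - (norm z)\<^sup>2) *\<^sub>R (u - T z z u)"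
  by (rule matrix_inv_mult_vec_eqI[OF invertible_gram]) (simp_all add: gram_mult_vec gram_op_inverse)

text \<open>The derivative of \<open>z \<mapsto> g z u v\<close> in the direction \<open>h\<close>; see \<open>metric_deriv\<close>.\<close>
definition metric_diff where
  "metric_diff z h u v = 2 * ((z \<bullet> h) * (u \<bullet> v) + T z h u \<bullet> v) / (1 - (norm z)\<^sup>2)\<^sup>2
     + 4 * (z \<bullet> h) * (T z z u \<bullet> v) / (1 - (norm z)\<^sup>2) ^ 3"

lemma bounded_bilinear_T: "bounded_bilinear (\<lambda>a b. T a b u)"
  unfolding bilinear_conv_bounded_bilinear[symmetric] bilinear_def
  by (auto intro!: linearI simp: T_add_right T_scaleR_right T_add_left T_scaleR_left)

lemma T_inner_deriv: "((\<lambda>z. T z z u \<bullet> v) has_derivative (\<lambda>h. 2 * (T z h u \<bullet> v))) (at z)"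
proof -
  have "((\<lambda>z. T z z u) has_derivative (\<lambda>h. T z h u + T h z u)) (at z)"
    by (rule bounded_bilinear.FDERIV[OF bounded_bilinear_T]) (rule has_derivative_ident)+
  thus ?thesis
    by (auto intro!: derivative_eq_intros simp: T_commute[of _ z] inner_add_left numeral_mult_vec)
qed

lemma norm_square_deriv: "((\<lambda>z. (norm z)\<^sup>2) has_derivative (\<lambda>h. 2 * (z \<bullet> h))) (at (z::real^'n))"
  unfolding power2_norm_eq_inner by (auto intro!: derivative_eq_intros simp: inner_commute)

lemma metric_deriv:
  assumes "norm z < 1"
  shows "((\<lambda>z. g z u v) has_derivative (\<lambda>h. metric_diff z h u v)) (at z)"
proof -
  define s where "s = (norm z)\<^sup>2"
  have s: "1 - s \<noteq> 0" using assms by (simp add: s_def power_less_one_iff less_imp_neq abs_square_eq_1)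
  define k where "k = (\<lambda>z::real^'n. inverse (1 - (norm z)\<^sup>2))"
  have s': "1 - (norm z)\<^sup>2 \<noteq> 0" using s by (simp add: s_def)
  have "((\<lambda>z::real^'n. 1 - (norm z)\<^sup>2) has_derivative (\<lambda>h. 0 - 2 * (z \<bullet> h))) (at z)"
    by (rule has_derivative_diff[OF has_derivative_const norm_square_deriv])
  from Deriv.has_derivative_inverse[OF s' this]
  have "(k has_derivative (\<lambda>h. - (k z * (0 - 2 * (z \<bullet> h)) * k z))) (at z)"
    unfolding k_def .
  hence k: "(k has_derivative (\<lambda>h. 2 * (z \<bullet> h) * (k z)\<^sup>2)) (at z)"
    by (simp add: power2_eq_square mult_ac)
  define F where "F = (\<lambda>z. T z z u \<bullet> v)"
  have F: "(F has_derivative (\<lambda>h. 2 * (T z h u \<bullet> v))) (at z)"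
    unfolding F_def by (rule T_inner_deriv)
  have "((\<lambda>z. (u \<bullet> v) * k z + F z * (k z)\<^sup>2) has_derivative
      (\<lambda>h. 2 * ((z \<bullet> h) * (u \<bullet> v) + T z h u \<bullet> v) * (k z)\<^sup>2
        + 4 * (z \<bullet> h) * F z * (k z) ^ 3)) (at z)"
    by (auto intro!: derivative_eq_intros k F simp: algebra_simps power2_eq_square power3_eq_cube)
  thus ?thesis by (simp add: metric_eq metric_diff_def k_def F_def divide_inverse power_inverse)
qed

lemma metric_diff_deriv_0:
  "((\<lambda>z. metric_diff z h u v) has_derivative (\<lambda>X. 2 * ((X \<bullet> h) * (u \<bullet> v) + T X h u \<bullet> v))) (at 0)"
proof -
  have 1: "((\<lambda>z. T z h u \<bullet> v) has_derivative (\<lambda>X. T X h u \<bullet> v)) (at 0)"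
    by (intro bounded_linear.has_derivative[OF bounded_linear_inner_left]
        bounded_linear_imp_has_derivative linear_conv_bounded_linear[THEN iffD1] T_linear_left)
  have T0: "T 0 b w = 0" for b w by (rule linear_0[OF T_linear_left])
  show ?thesis
    unfolding metric_diff_def
    by (rule derivative_eq_intros norm_square_deriv T_inner_deriv 1 refl | (simp; fail))+
       (simp add: fun_eq_iff T0)
qed

text \<open>The Christoffel symbols with the index lowered.\<close>
definition koszul where
  "koszul z u v = (\<chi> k. (metric_diff z u v (axis k 1) + metric_diff z v u (axis k 1) - metric_diff z (axis k 1) u v) / 2)"

lemma christoffel_eq:
  assumes z: "norm z < 1"
  shows "christoffel g z u v = (\<Sum>k\<in>UNIV. (koszul z u v $ k * (1 - (norm z)\<^sup>2)) *\<^sub>R (axis k 1 - T z z (axis k 1)))"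
proof -
  have "frechet_derivative (\<lambda>z. g z a b) (at z) = (\<lambda>h. metric_diff z h a b)" for a b
    by (rule frechet_derivative_at[OF metric_deriv[OF z], symmetric])
  hence "christoffel g z u v = (1 - (norm z)\<^sup>2) *\<^sub>R (koszul z u v - T z z (koszul z u v))"
    by (simp add: christoffel_def koszul_def matrix_inv_gram[OF z])
  also have "koszul z u v = (\<Sum>k\<in>UNIV. koszul z u v $ k *\<^sub>R axis k 1)"
    by (simp add: vec_eq_iff axis_def if_distrib cong: if_cong)
  also have "(1 - (norm z)\<^sup>2) *\<^sub>R ((\<Sum>k\<in>UNIV. koszul z u v $ k *\<^sub>R axis k 1) - T z z (\<Sum>k\<in>UNIV. koszul z u v $ k *\<^sub>R axis k 1))
      = (\<Sum>k\<in>UNIV. (koszul z u v $ k * (1 - (norm z)\<^sup>2)) *\<^sub>R (axis k 1 - T z z (axis k 1)))"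
    by (simp add: linear_sum[OF T_linear] linear_cmul[OF T_linear] scaleR_right.sum sum_subtractf[symmetric]
        scaleR_diff_right mult.commute)
  finally show ?thesis .
qed

lemma koszul_deriv_0:
  "((\<lambda>z. koszul z u v $ k) has_derivative (\<lambda>X. (X \<bullet> u) * (v $ k) + T X u v $ k + (X \<bullet> v) * u $ k + T X v u $ k
      - (X $ k * (u \<bullet> v) + T X (axis k 1) u \<bullet> v))) (at 0)"
  unfolding koszul_def vec_lambda_beta
  by (rule derivative_eq_intros metric_diff_deriv_0 refl | (simp; fail))+
     (simp add: fun_eq_iff inner_axis field_simps)

lemma koszul_0: "koszul 0 u v = 0"
  by (simp add: koszul_def metric_diff_def vec_eq_iff linear_0[OF T_linear_left])

lemma christoffel_0: "christoffel g 0 u v = 0"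
  by (subst christoffel_eq) (simp_all add: koszul_0)

text \<open>The lowered symbols vanish at the centre, so the derivative of the inverse metric does not contribute.\<close>
lemma christoffel_deriv_0:
  "frechet_derivative (\<lambda>z. christoffel g z u v) (at 0) X =
     (\<chi> k. (X \<bullet> u) * (v $ k) + T X u v $ k + (X \<bullet> v) * u $ k + T X v u $ k
      - (X $ k * (u \<bullet> v) + T X (axis k 1) u \<bullet> v))" (is "_ = ?D X")
proof -
  have Td: "((\<lambda>z. T z z w) has_derivative (\<lambda>h. T 0 h w + T h 0 w)) (at 0)" for w
    by (rule bounded_bilinear.FDERIV[OF bounded_bilinear_T]) (rule has_derivative_ident)+
  have T0: "T 0 b w = 0" "T b 0 w = 0" for b w
    using linear_0[OF T_linear_left] T_commute by metis+
  have "((\<lambda>z. (koszul z u v $ k * (1 - (norm z)\<^sup>2)) *\<^sub>R (axis k 1 - T z z (axis k 1)))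
     has_derivative (\<lambda>X. ?D X $ k *\<^sub>R axis k 1)) (at 0)" for k
    by (rule derivative_eq_intros koszul_deriv_0 norm_square_deriv Td refl)+
       (simp add: fun_eq_iff koszul_0 T0)
  hence "((\<lambda>z. \<Sum>k\<in>UNIV. (koszul z u v $ k * (1 - (norm z)\<^sup>2)) *\<^sub>R (axis k 1 - T z z (axis k 1)))
     has_derivative (\<lambda>X. \<Sum>k\<in>UNIV. ?D X $ k *\<^sub>R axis k 1)) (at 0)"
    by (rule has_derivative_sum)
  moreover have "(\<Sum>k\<in>UNIV. ?D X $ k *\<^sub>R axis k 1) = ?D X" for X
    by (simp add: vec_eq_iff axis_def if_distrib cong: if_cong)
  ultimately have "((\<lambda>z. \<Sum>k\<in>UNIV. (koszul z u v $ k * (1 - (norm z)\<^sup>2)) *\<^sub>R (axis k 1 - T z z (axis k 1)))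
     has_derivative ?D) (at 0)" by (simp only:)
  hence "((\<lambda>z. christoffel g z u v) has_derivative ?D) (at 0)"
    by (rule has_derivative_transform_within_open[where s = "ball 0 1"]) (simp_all add: christoffel_eq)
  thus ?thesis by (rule frechet_derivative_at[symmetric, THEN fun_cong])
qed

text \<open>With vanishing Christoffel symbols at the centre, the curvature is an alternating sum of values of
  \<open>K(a,b;u,v) = (a \<bullet> b) (u \<bullet> v) + T a b u \<bullet> v\<close>. The Euclidean part contributes \<open>- 2 X\<close>. In the remaining part
  the two terms with \<open>\<theta>\<close> in mixed position are given by \<open>T_self_polarized\<close> and contribute \<open>X - P\<^sub>\<theta> X\<close>
  together, and the two others contribute \<open>- P\<^sub>\<theta> X\<close> each, one of them by reciprocity.\<close>
lemma curvature_at_centre: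
  assumes \<theta>: "norm \<theta> = 1" and X: "X \<bullet> \<theta> = 0"
  shows "curvature g 0 X \<theta> \<theta> = - X - 3 *\<^sub>R P \<theta> X"
proof -
  have "curvature g 0 X \<theta> \<theta> $ k = (- X - 3 *\<^sub>R P \<theta> X) $ k" for k
  proof -
    define e :: "real^'n" where "e = axis k 1"
    have k: "w $ k = w \<bullet> e" for w by (simp add: e_def inner_axis)
    have 1: "T \<theta> \<theta> w = P \<theta> w" for w by (simp add: T_diag \<theta>)
    have 2: "2 *\<^sub>R T \<theta> w \<theta> = (2 * (\<theta> \<bullet> w)) *\<^sub>R \<theta> + w - P \<theta> w" for w
      using T_self_polarized[of \<theta> w] by (simp add: 1 \<theta> algebra_simps)
    have 3: "2 * (T \<theta> w \<theta> \<bullet> y) = 2 * (\<theta> \<bullet> w) * (\<theta> \<bullet> y) + w \<bullet> y - P \<theta> w \<bullet> y" for w y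
      using arg_cong[OF 2, of "\<lambda>a. a \<bullet> y", of w] by (simp add: inner_add_left inner_diff_left)
    have t: "\<theta> \<bullet> \<theta> = 1" "\<theta> \<bullet> X = 0" using \<theta> X by (simp_all add: norm_eq_1 inner_commute)
    have "curvature g 0 X \<theta> \<theta> $ k
        = (T X \<theta> \<theta> \<bullet> e) * 2 - (X \<bullet> e + T X e \<theta> \<bullet> \<theta>)
          - (X \<bullet> e + T \<theta> X \<theta> \<bullet> e + T \<theta> \<theta> X \<bullet> e - T \<theta> e X \<bullet> \<theta>)"
      by (simp add: curvature_def christoffel_0 christoffel_deriv_0 X t) (simp add: k e_def[symmetric])
    also have "T \<theta> e X \<bullet> \<theta> = T \<theta> e \<theta> \<bullet> X" using T_symmetric[of \<theta> e X \<theta>] by (simp add: inner_commute)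
    also have "T X e \<theta> \<bullet> \<theta> = P \<theta> X \<bullet> e" using T_reciprocal_polarized[of X e \<theta>] by (simp only: 1)
    finally have "curvature g 0 X \<theta> \<theta> $ k = - (X \<bullet> e) - 3 * (P \<theta> X \<bullet> e)"
      using 3[of X e] 3[of e X] P_inner_commute[of \<theta> e X] t
      by (simp add: 1 T_commute[of X \<theta>] inner_commute)
    also have "\<dots> = (- X - 3 *\<^sub>R P \<theta> X) $ k" by (simp add: k inner_diff_left)
    finally show ?thesis .
  qed
  thus ?thesis by (simp add: vec_eq_iff)
qed

lemma metric_0: "g 0 u v = u \<bullet> v"
  by (simp add: ball_metric_def)

lemma hspace_orthogonal:
  assumes "norm \<theta> = 1" "X \<in> hspace g \<theta>"
  shows "P \<theta> X = 0"
  using assms curvature_at_centre[of \<theta> X] by (simp add: hspace_def metric_0)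

lemma vspace_mem:
  assumes "norm \<theta> = 1" "X \<in> vspace g \<theta>"
  shows "P \<theta> X = X" "X \<bullet> \<theta> = 0"
proof -
  show X: "X \<bullet> \<theta> = 0" using assms by (simp add: vspace_def metric_0)
  have "- X - 3 *\<^sub>R P \<theta> X = - 4 *\<^sub>R X"
    using assms X curvature_at_centre[of \<theta> X] by (simp add: vspace_def)
  hence "3 *\<^sub>R P \<theta> X = 3 *\<^sub>R X" by (simp add: algebra_simps vec_eq_iff)
  thus "P \<theta> X = X" by simp
qed

end

section \<open>The complex, quaternionic and octonionic lines\<close>

text \<open>The complex and quaternionic cases together: if \<open>f 0 z, \<dots>, f q z\<close> is an orthogonal basis of the line
  with vectors of length \<open>|z|\<close>, then \<open>|z|\<^sup>2 P\<^sub>z u = \<Sum> (f i z \<bullet> u) f i z\<close> is visibly quadratic in \<open>z\<close>, and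
  reciprocity holds because each \<open>f i\<close> with \<open>i > 0\<close> is skew.\<close>
lemma line_field_span:
  fixes f :: "nat \<Rightarrow> real^'n::finite \<Rightarrow> real^'n"
  assumes lin: "\<And>i. i \<le> q \<Longrightarrow> linear (f i)"
    and f0: "\<And>z. f 0 z = z"
    and orth: "\<And>i j z. i \<le> q \<Longrightarrow> j \<le> q \<Longrightarrow> f i z \<bullet> f j z = (if i = j then (norm z)\<^sup>2 else 0)"
    and skew: "\<And>i z u. 0 < i \<Longrightarrow> i \<le> q \<Longrightarrow> f i z \<bullet> u = - (z \<bullet> f i u)"
  shows "line_field (\<lambda>z. span ((\<lambda>i. f i z) ` {..q}))
           (\<lambda>a b u. \<Sum>i\<le>q. (1/2) *\<^sub>R ((f i a \<bullet> u) *\<^sub>R f i b + (f i b \<bullet> u) *\<^sub>R f i a)) q"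
    (is "line_field ?L ?T q")
proof (rule line_field.intro)
  have fl: "f i (x + y) = f i x + f i y" "f i (c *\<^sub>R x) = c *\<^sub>R f i x" if "i \<le> q" for i x y c
    using lin[OF that] by (simp_all add: linear_add linear_cmul)
  have diag: "?T z z u = (\<Sum>i\<le>q. (f i z \<bullet> u) *\<^sub>R f i z)" for z u
    by (simp add: numeral_mult_vec)
  show "subspace (?L z)" for z by simp
  show "z \<in> ?L z" for z
    by (rule span_base) (auto intro!: image_eqI[of _ _ 0] simp: f0)
  have sub: "?L (c *\<^sub>R z) \<subseteq> ?L z" for c z
  proof (rule span_minimal)
    show "(\<lambda>i. f i (c *\<^sub>R z)) ` {..q} \<subseteq> ?L z"
    proof
      fix x assume "x \<in> (\<lambda>i. f i (c *\<^sub>R z)) ` {..q}"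
      then obtain i where "i \<le> q" "x = c *\<^sub>R f i z" by (auto simp: fl)
      thus "x \<in> ?L z" by (simp add: span_scale span_base)
    qed
  qed simp
  show "?L (c *\<^sub>R z) = ?L z" if "c \<noteq> 0" for c z
    using sub[of c z] sub[of "1 / c" "c *\<^sub>R z"] that by auto
  show "dim (?L z) = q + 1" if "z \<noteq> 0" for z
  proof -
    have inj: "inj_on (\<lambda>i. f i z) {..q}"
    proof (rule inj_onI)
      fix i j assume "i \<in> {..q}" "j \<in> {..q}" "f i z = f j z"
      thus "i = j" using orth[of i j z] orth[of i i z] that by (auto split: if_splits)
    qed
    have "pairwise orthogonal ((\<lambda>i. f i z) ` {..q})"
      by (auto simp: pairwise_def orthogonal_def orth)
    moreover have "0 \<notin> (\<lambda>i. f i z) ` {..q}"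
    proof
      assume "0 \<in> (\<lambda>i. f i z) ` {..q}"
      then obtain i where "i \<le> q" "f i z = 0" by auto
      thus False using orth[of i i z] that by simp
    qed
    ultimately have "independent ((\<lambda>i. f i z) ` {..q})" by (rule pairwise_orthogonal_independent)
    thus ?thesis using inj by (simp add: dim_eq_card_independent card_image)
  qed
  show "linear (?T a b)" for a b
    by (rule linearI) (simp_all add: inner_add_right sum.distrib[symmetric] scaleR_sum_right algebra_simps)
  show "linear (\<lambda>a. ?T a b u)" for b u
    by (rule linearI)
       (simp_all add: fl inner_add_left sum.distrib[symmetric] scaleR_sum_right algebra_simps)
  show "?T a b u = ?T b a u" for a b u by (simp add: add.commute)
  show "?T z z u = (norm z)\<^sup>2 *\<^sub>R closest_point (?L z) u" for z u
  proof (cases "z = 0")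
    case True
    thus ?thesis using lin by (simp add: linear_0)
  next
    case False
    have "closest_point (?L z) u = (1 / (norm z)\<^sup>2) *\<^sub>R ?T z z u"
    proof (rule closest_point_subspace_eqI)
      show "subspace (?L z)" by simp
      show "(1 / (norm z)\<^sup>2) *\<^sub>R ?T z z u \<in> ?L z"
        unfolding diag by (intro span_scale span_sum span_base) auto
      fix k assume k: "k \<in> ?L z"
      have "orthogonal (u - (1 / (norm z)\<^sup>2) *\<^sub>R ?T z z u) k"
      proof (rule orthogonal_to_span[OF k])
        fix x assume "x \<in> (\<lambda>i. f i z) ` {..q}"
        then obtain j where j: "j \<le> q" "x = f j z" by auto
        have "?T z z u \<bullet> x = (\<Sum>i\<le>q. (f i z \<bullet> u) * (f i z \<bullet> f j z))"
          unfolding diag j(2) by (simp add: inner_sum_left)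
        also have "\<dots> = (\<Sum>i\<le>q. if i = j then (f j z \<bullet> u) * (norm z)\<^sup>2 else 0)"
          using j(1) by (intro sum.cong) (auto simp: orth)
        also have "\<dots> = (f j z \<bullet> u) * (norm z)\<^sup>2" using j(1) by simp
        finally show "orthogonal (u - (1 / (norm z)\<^sup>2) *\<^sub>R ?T z z u) x"
          using False j(2) unfolding diag orthogonal_def
          by (simp add: inner_diff_left inner_diff_right inner_commute)
      qed
      thus "(u - (1 / (norm z)\<^sup>2) *\<^sub>R ?T z z u) \<bullet> k = 0" by (simp add: orthogonal_def)
    qed
    thus ?thesis using False by simp
  qed
  have sq: "?T z z u \<bullet> u = (\<Sum>i\<le>q. (f i z \<bullet> u)\<^sup>2)" for z u
    unfolding diag by (simp add: inner_sum_left power2_eq_square)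
  show "?T z z u \<bullet> u = ?T u u z \<bullet> z" for z u
    unfolding sq
  proof (rule sum.cong[OF refl])
    fix i assume "i \<in> {..q}"
    hence "i = 0 \<or> f i z \<bullet> u = - (f i u \<bullet> z)"
      using skew[of i z u] by (auto simp: inner_commute)
    thus "(f i z \<bullet> u)\<^sup>2 = (f i u \<bullet> z)\<^sup>2"
      by (auto simp: f0 inner_commute)
  qed
qed

lemma complex_structure:
  fixes J :: "real^'n::finite \<Rightarrow> real^'n"
  assumes J: "orthogonal_transformation J" "\<And>x. J (J x) = - x"
  shows "J z \<bullet> u = - (z \<bullet> J u)" and "z \<bullet> J z = 0" and "J z \<bullet> J u = z \<bullet> u" and "linear J"
proof -
  show o: "J z \<bullet> J u = z \<bullet> u" for z u using J(1) by (simp add: orthogonal_transformation_def)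
  show s: "J z \<bullet> u = - (z \<bullet> J u)" for z u using o[of "J z" u] by (simp add: J(2))
  show "z \<bullet> J z = 0" using s[of z z] by (simp add: inner_commute)
  show "linear J" using J(1) by (simp add: orthogonal_transformation_def)
qed

lemma complex_hyperbolic_line_field:
  assumes "complex_hyperbolic m g"
  obtains L T where "line_field L T 1" "g = ball_metric L"
proof -
  obtain J where J: "orthogonal_transformation J" "\<And>x. J (J x) = - x"
    and g: "g = ball_metric (\<lambda>x. span {x, J x})"
    using assms by (auto simp: complex_hyperbolic_def)
  note cs = complex_structure[OF J]
  define f where "f = (\<lambda>i::nat. if i = 0 then id else J)"
  have "(\<lambda>i. f i z) ` {..1} = {z, J z}" for z
    by (auto simp: f_def atMost_Suc)
  moreover have "line_field (\<lambda>z. span ((\<lambda>i. f i z) ` {..1}))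
           (\<lambda>a b u. \<Sum>i\<le>1. (1/2) *\<^sub>R ((f i a \<bullet> u) *\<^sub>R f i b + (f i b \<bullet> u) *\<^sub>R f i a)) 1"
    by (rule line_field_span)
       (auto simp: f_def cs J(2) linear_id power2_norm_eq_inner inner_commute[of "J _"] split: if_splits)
  ultimately show ?thesis using g that by simp
qed

lemma quaternionic_hyperbolic_line_field:
  assumes "quaternionic_hyperbolic m g"
  obtains L T where "line_field L T 3" "g = ball_metric L"
proof -
  obtain I J where I: "orthogonal_transformation I" "\<And>x. I (I x) = - x"
    and J: "orthogonal_transformation J" "\<And>x. J (J x) = - x"
    and IJ: "\<And>x. I (J x) = - J (I x)"
    and g: "g = ball_metric (\<lambda>x. span {x, I x, J x, I (J x)})"
    using assms by (auto simp: quaternionic_hyperbolic_def)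
  define K where "K = I \<circ> J"
  have lI: "linear I" using I(1) by (simp add: orthogonal_transformation_def)
  have K: "orthogonal_transformation K" "\<And>x. K (K x) = - x"
  proof -
    show "orthogonal_transformation K"
      unfolding K_def by (rule orthogonal_transformation_compose[OF I(1) J(1)])
    fix x
    have "J (I (J x)) = - I (J (J x))" using IJ[of "J x"] by simp
    hence "J (I (J x)) = I x" using J(2) linear_neg[OF lI] by simp
    thus "K (K x) = - x" by (simp add: K_def I(2))
  qed
  note cI = complex_structure[OF I] and cJ = complex_structure[OF J] and cK = complex_structure[OF K]
  have IJ0: "I z \<bullet> J z = 0" for z
    using cI(1)[of z "J z"] cK(2)[of z] by (simp add: K_def)
  have IK0: "I z \<bullet> K z = 0" for z
    using cI(3)[of z "J z"] cJ(2)[of z] by (simp add: K_def)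
  have JK0: "J z \<bullet> K z = 0" for z
    using cI(2)[of "J z"] by (simp add: K_def)
  define f where "f = (\<lambda>i::nat. if i = 0 then id else if i = 1 then I else if i = 2 then J else K)"
  have set: "(\<lambda>i. f i z) ` {..3} = {z, I z, J z, I (J z)}" for z
    by (auto simp: f_def atMost_Suc K_def numeral_3_eq_3)
  have i: "i = 0 \<or> i = 1 \<or> i = 2 \<or> i = 3" if "i \<le> 3" for i :: nat using that by auto
  have "line_field (\<lambda>z. span ((\<lambda>i. f i z) ` {..3}))
           (\<lambda>a b u. \<Sum>i\<le>3. (1/2) *\<^sub>R ((f i a \<bullet> u) *\<^sub>R f i b + (f i b \<bullet> u) *\<^sub>R f i a)) 3"
  proof (rule line_field_span)
    show "linear (f i)" for i by (auto simp: f_def cI cJ cK linear_id)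
    show "f 0 z = z" for z by (simp add: f_def)
    show "f i z \<bullet> u = - (z \<bullet> f i u)" if "0 < i" for i z u
      using that by (simp add: f_def cI(1) cJ(1) cK(1))
    show "f i z \<bullet> f j z = (if i = j then (norm z)\<^sup>2 else 0)" if "i \<le> 3" "j \<le> 3" for i j z
      using i[OF that(1)] i[OF that(2)] cI(2)[of z] cJ(2)[of z] cK(2)[of z] IJ0[of z] IK0[of z] JK0[of z]
      by (auto simp: f_def cI(3) cJ(3) cK(3) power2_norm_eq_inner inner_commute)
  qed
  thus ?thesis using g that by (simp add: set)
qed

lemma omult_add_left: "omult (a + b) c = omult a c + omult b c"
  and omult_add_right: "omult a (c + d) = omult a c + omult a d"
  and ocnj_add: "ocnj (a + b) = ocnj a + ocnj b"
  by (cases a; cases b; cases c; cases d; auto simp: algebra_simps)+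

lemma omult_scaleR_left: "omult (r *\<^sub>R a) c = r *\<^sub>R omult a c"
  and omult_scaleR_right: "omult a (r *\<^sub>R c) = r *\<^sub>R omult a c"
  and ocnj_scaleR: "ocnj (r *\<^sub>R a) = r *\<^sub>R ocnj a"
  by (cases a; cases c; auto simp: algebra_simps scaleR_conv_of_real)+

lemma ocnj_ocnj: "ocnj (ocnj a) = a"
  by (cases a) auto

lemma ocnj_omult: "ocnj (omult a b) = omult (ocnj b) (ocnj a)"
  by (cases a; cases b) (auto simp: algebra_simps)

lemma norm_ocnj: "norm (ocnj a) = norm a"
  by (cases a) (auto simp: norm_Pair)

text \<open>The adjoint of an octonionic multiplication is the multiplication by the conjugate. Together with
  the left alternative law below this replaces associativity.\<close>
lemma omult_inner_left: "omult a b \<bullet> c = b \<bullet> omult (ocnj a) c"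
  by (cases a; cases b; cases c) (auto simp: inner_complex_def algebra_simps)

lemma omult_inner_right: "omult a b \<bullet> c = a \<bullet> omult c (ocnj b)"
  by (cases a; cases b; cases c) (auto simp: inner_complex_def algebra_simps)

lemma omult_ocnj_cancel_left: "omult (ocnj a) (omult a b) = (norm a)\<^sup>2 *\<^sub>R b"
  by (cases a; cases b)
     (auto simp: norm_Pair scaleR_conv_of_real complex_norm_square algebra_simps simp del: of_real_power)

lemma omult_omult_ocnj: "omult a (omult (ocnj a) b) = (norm a)\<^sup>2 *\<^sub>R b"
  using omult_ocnj_cancel_left[of "ocnj a" b] by (simp add: ocnj_ocnj norm_ocnj)

lemma norm_omult_square: "(norm (omult a b))\<^sup>2 = (norm a)\<^sup>2 * (norm b)\<^sup>2"
  by (simp add: power2_norm_eq_inner omult_inner_left omult_ocnj_cancel_left)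

lemma omult_cancel_right: "omult (omult b (ocnj a)) a = (norm a)\<^sup>2 *\<^sub>R b"
proof -
  have "ocnj (omult (omult b (ocnj a)) a) = (norm a)\<^sup>2 *\<^sub>R ocnj b"
    by (simp add: ocnj_omult ocnj_ocnj omult_ocnj_cancel_left)
  hence "ocnj (ocnj (omult (omult b (ocnj a)) a)) = ocnj ((norm a)\<^sup>2 *\<^sub>R ocnj b)" by simp
  thus ?thesis by (simp only: ocnj_ocnj ocnj_scaleR)
qed

lemma omult_inner_omult: "omult a b \<bullet> omult a c = (norm a)\<^sup>2 * (b \<bullet> c)"
  by (simp add: omult_inner_left omult_ocnj_cancel_left)

text \<open>Both kinds of lines are images of the octonions under an injective linear map; the slope \<open>b a\<^sup>-\<^sup>1\<close> is
  written as \<open>(b a\<^sup>*) / |a|\<^sup>2\<close>.\<close>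
lemma octonionic_line_eq:
  "octonionic_line (a, b) = (if a = 0 then range (\<lambda>u. (0, u))
     else range (\<lambda>u. (u, (1 / (norm a)\<^sup>2) *\<^sub>R omult (omult b (ocnj a)) u)))"
  by (auto simp: oinv_def omult_scaleR_left omult_scaleR_right divide_inverse)

lemma octonionic_line_linear_param:
  obtains h :: "oct \<Rightarrow> oct \<times> oct" where "linear h" "inj h" "octonionic_line z = range h"
proof (cases z)
  fix a b assume Pair: "z = (a, b)"
  show ?thesis
  proof (cases "a = 0")
    case True
    have "linear (\<lambda>u::oct. (0::oct, u))" by (rule linearI) simp_all
    moreover have "inj (\<lambda>u::oct. (0::oct, u))" by (rule injI) simp
    ultimately show ?thesis
      by (rule that) (simp add: True Pair octonionic_line_eq del: octonionic_line.simps)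
  next
    case False
    have "linear (\<lambda>u. (u, (1 / (norm a)\<^sup>2) *\<^sub>R omult (omult b (ocnj a)) u))"
      by (rule linearI) (simp_all add: omult_add_right omult_scaleR_right scaleR_add_right)
    moreover have "inj (\<lambda>u. (u, (1 / (norm a)\<^sup>2) *\<^sub>R omult (omult b (ocnj a)) u))"
      by (rule injI) simp
    ultimately show ?thesis
      by (rule that) (simp only: False Pair octonionic_line_eq if_False)
  qed
qed

lemma subspace_octonionic_line: "subspace (octonionic_line z)"
proof -
  obtain h :: "oct \<Rightarrow> oct \<times> oct" where "linear h" "octonionic_line z = range h"
    by (rule octonionic_line_linear_param)
  thus ?thesis by (simp add: linear_subspace_image)
qed

lemma dim_octonionic_line: "dim (octonionic_line z) = 8"
proof -
  obtain h :: "oct \<Rightarrow> oct \<times> oct" where "linear h" "inj h" "octonionic_line z = range h"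
    by (rule octonionic_line_linear_param)
  thus ?thesis by (simp add: dim_image_eq)
qed

lemma mem_octonionic_line: "z \<in> octonionic_line z"
proof (cases z)
  fix a b assume Pair: "z = (a, b)"
  have "b = (1 / (norm a)\<^sup>2) *\<^sub>R omult (omult b (ocnj a)) a" if "a \<noteq> 0"
    using that by (simp add: omult_cancel_right)
  thus ?thesis unfolding Pair octonionic_line_eq by (auto intro!: image_eqI[of _ _ a])
qed

lemma octonionic_line_scaleR: "c \<noteq> 0 \<Longrightarrow> octonionic_line (c *\<^sub>R z) = octonionic_line z"
proof (cases z)
  fix a b assume Pair: "z = (a, b)"
  assume c: "c \<noteq> 0"
  have "(1 / (norm (c *\<^sub>R a))\<^sup>2) *\<^sub>R omult (omult (c *\<^sub>R b) (ocnj (c *\<^sub>R a))) u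
      = (1 / (norm a)\<^sup>2) *\<^sub>R omult (omult b (ocnj a)) u" for u
    using c by (simp add: omult_scaleR_left omult_scaleR_right ocnj_scaleR power_mult_distrib
        flip: power2_eq_square)
  thus ?thesis using c unfolding Pair scaleR_Pair octonionic_line_eq by simp
qed

text \<open>The polarization of \<open>z \<mapsto> |z|\<^sup>2 P\<^sub>z\<close>. Its value on the diagonal is given by \<open>octonionic_form_diag\<close>; being
  polynomial, it also covers the line with \<open>a = 0\<close>, whose slope is infinite.\<close>
definition octonionic_form :: "oct \<times> oct \<Rightarrow> oct \<times> oct \<Rightarrow> oct \<times> oct \<Rightarrow> oct \<times> oct" where
  "octonionic_form z w u =
     ((fst z \<bullet> fst w) *\<^sub>R fst u
        + (1 / 2) *\<^sub>R (omult (omult (fst z) (ocnj (snd w))) (snd u) + omult (omult (fst w) (ocnj (snd z))) (snd u)),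
      (1 / 2) *\<^sub>R (omult (omult (snd z) (ocnj (fst w))) (fst u) + omult (omult (snd w) (ocnj (fst z))) (fst u))
        + (snd z \<bullet> snd w) *\<^sub>R snd u)"

lemma octonionic_form_diag:
  "octonionic_form (a, b) (a, b) (c, d)
     = ((norm a)\<^sup>2 *\<^sub>R c + omult (omult a (ocnj b)) d, omult (omult b (ocnj a)) c + (norm b)\<^sup>2 *\<^sub>R d)"
proof -
  have "(1 / 2) *\<^sub>R (x + x) = x" for x :: oct by (rule scaleR_half_double)
  thus ?thesis by (simp add: octonionic_form_def power2_norm_eq_inner)
qed

lemma octonionic_form_mem: "octonionic_form z z u \<in> octonionic_line z"
proof (cases z; cases u)
  fix a b c d assume z: "z = (a, b)" and u: "u = (c, d)"
  let ?x = "omult b (ocnj a)"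
  have x: "omult a (ocnj b) = ocnj ?x" by (simp add: ocnj_omult ocnj_ocnj)
  have "omult ?x c + (norm b)\<^sup>2 *\<^sub>R d
      = (1 / (norm a)\<^sup>2) *\<^sub>R omult ?x ((norm a)\<^sup>2 *\<^sub>R c + omult (omult a (ocnj b)) d)" if "a \<noteq> 0"
    using that unfolding x
    by (simp add: omult_add_right omult_scaleR_right omult_omult_ocnj norm_omult_square norm_ocnj scaleR_add_right)
  moreover have "omult (omult 0 y) w = 0" "omult y 0 = 0" for y w
    using omult_scaleR_left[of 0] omult_scaleR_right[of _ 0] by simp_all
  ultimately show ?thesis
    unfolding z u octonionic_form_diag octonionic_line_eq by (auto intro!: image_eqI)
qed

text \<open>For a vector \<open>(v, |a|\<^sup>-\<^sup>2 x v)\<close> of the line, with \<open>x = b a\<^sup>*\<close>, the inner products follow from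
  \<open>x c \<bullet> x v = |x|\<^sup>2 (c \<bullet> v)\<close> and \<open>|x| = |a| |b|\<close>.\<close>
lemma octonionic_form_orthogonal:
  assumes k: "k \<in> octonionic_line z"
  shows "octonionic_form z z u \<bullet> k = (norm z)\<^sup>2 * (u \<bullet> k)"
proof (cases z; cases u)
  fix a b c d assume z: "z = (a, b)" and u: "u = (c, d)"
  let ?x = "omult b (ocnj a)"
  have x: "omult a (ocnj b) = ocnj ?x" by (simp add: ocnj_omult ocnj_ocnj)
  have z0: "omult 0 y = 0" "omult y 0 = 0" "ocnj 0 = 0" for y
    using omult_scaleR_left[of 0] omult_scaleR_right[of _ 0] ocnj_scaleR[of 0] by simp_all
  have n: "(norm z)\<^sup>2 = (norm a)\<^sup>2 + (norm b)\<^sup>2" by (simp add: z norm_Pair)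
  show ?thesis
  proof (cases "a = 0")
    case True
    then obtain v where "k = (0, v)" using k by (auto simp: z octonionic_line_eq)
    thus ?thesis using True unfolding n unfolding z u octonionic_form_diag by (simp add: z0)
  next
    case False
    then obtain v where v: "k = (v, (1 / (norm a)\<^sup>2) *\<^sub>R omult ?x v)"
      using k unfolding z octonionic_line_eq by auto
    have 1: "omult ?x c \<bullet> omult ?x v = (norm b)\<^sup>2 * (norm a)\<^sup>2 * (c \<bullet> v)"
      by (simp add: omult_inner_omult norm_omult_square norm_ocnj)
    have 2: "omult (ocnj ?x) d \<bullet> v = d \<bullet> omult ?x v"
      by (simp add: omult_inner_left ocnj_ocnj)
    have "octonionic_form z z u \<bullet> k = (norm a)\<^sup>2 * (c \<bullet> v) + d \<bullet> omult ?x v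
        + (1 / (norm a)\<^sup>2) * ((norm b)\<^sup>2 * (norm a)\<^sup>2 * (c \<bullet> v) + (norm b)\<^sup>2 * (d \<bullet> omult ?x v))"
      unfolding z u v octonionic_form_diag x by (simp add: inner_add_left 1 2 add_divide_distrib)
    also have "\<dots> = (norm z)\<^sup>2 * (u \<bullet> k)"
      unfolding n unfolding u v using False by (simp add: field_simps)
    finally show ?thesis .
  qed
qed

text \<open>Both sides equal \<open>|a|\<^sup>2 |c|\<^sup>2 + 2 (a b\<^sup>*) \<bullet> (c d\<^sup>*) + |b|\<^sup>2 |d|\<^sup>2\<close>, by moving the factor \<open>d\<close> to the other
  side of the inner product.\<close>
lemma octonionic_form_reciprocal:
  "octonionic_form z z u \<bullet> u = octonionic_form u u z \<bullet> z"
proof (cases z; cases u)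
  fix a b c d assume z: "z = (a, b)" and u: "u = (c, d)"
  have *: "octonionic_form (a, b) (a, b) (c, d) \<bullet> (c, d)
     = (norm a)\<^sup>2 * (norm c)\<^sup>2 + 2 * (omult a (ocnj b) \<bullet> omult c (ocnj d)) + (norm b)\<^sup>2 * (norm d)\<^sup>2" for a b c d
  proof -
    have "omult (omult b (ocnj a)) c \<bullet> d = omult (omult a (ocnj b)) d \<bullet> c"
      using omult_inner_left[of "omult b (ocnj a)" c d] by (simp add: ocnj_omult ocnj_ocnj inner_commute)
    moreover have "omult (omult a (ocnj b)) d \<bullet> c = omult a (ocnj b) \<bullet> omult c (ocnj d)"
      by (rule omult_inner_right)
    ultimately show ?thesis
      by (simp add: octonionic_form_diag inner_add_left power2_norm_eq_inner)
  qed
  show ?thesis unfolding z u * by (simp add: inner_commute)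
qed

lemma octonionic_form_linear:
  "linear (octonionic_form z w)" "linear (\<lambda>z. octonionic_form z w u)"
  by (rule linearI; simp add: octonionic_form_def omult_add_left omult_add_right omult_scaleR_left
      omult_scaleR_right ocnj_add ocnj_scaleR inner_add_left algebra_simps)+

lemma octonionic_form_commute: "octonionic_form z w u = octonionic_form w z u"
  by (simp add: octonionic_form_def inner_commute add.commute)

lemma octonionic_hyperbolic_plane_line_field:
  fixes g :: "'n::finite metric"
  assumes "octonionic_hyperbolic_plane g"
  obtains L T where "line_field L T 7" "g = ball_metric L"
proof -
  obtain \<Phi> :: "real^'n \<Rightarrow> oct \<times> oct" where lin: "linear \<Phi>" and nrm: "\<And>x. norm (\<Phi> x) = norm x"
    and g: "g = ball_metric (\<lambda>x. {u. \<Phi> u \<in> octonionic_line (\<Phi> x)})" and C: "CARD('n) = 16"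
    using assms by (auto simp: octonionic_hyperbolic_plane_def)
  have inj: "inj \<Phi>"
    using linear_injective_0[OF lin] nrm by (metis norm_eq_zero)
  have "dim (range \<Phi>) = DIM(oct \<times> oct)"
    using lin inj C by (simp add: dim_image_eq)
  hence surj: "surj \<Phi>"
    using dim_eq_full[of "range \<Phi>"] lin by (simp add: span_eq_iff[THEN iffD2] linear_subspace_image)
  define \<Psi> where "\<Psi> = inv \<Phi>"
  have \<Phi>\<Psi>: "\<Phi> (\<Psi> y) = y" for y using surj by (simp add: \<Psi>_def surj_f_inv_f)
  have \<Psi>\<Phi>: "\<Psi> (\<Phi> x) = x" for x using inj by (simp add: \<Psi>_def)
  have l\<Psi>: "linear \<Psi>"
    by (rule linearI; rule injD[OF inj])
       (simp_all add: \<Phi>\<Psi> linear_add[OF lin] linear_cmul[OF lin])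
  have inner: "\<Phi> x \<bullet> \<Phi> y = x \<bullet> y" for x y
    using nrm[of "x + y"] nrm[of x] nrm[of y]
    by (simp add: linear_add[OF lin] norm_eq_sqrt_inner inner_add_left inner_add_right inner_commute)
  have adj: "\<Psi> y \<bullet> x = y \<bullet> \<Phi> x" for x y using inner[of "\<Psi> y" x] by (simp add: \<Phi>\<Psi>)
  let ?L = "\<lambda>x. {u. \<Phi> u \<in> octonionic_line (\<Phi> x)}"
  let ?T = "\<lambda>a b u. \<Psi> (octonionic_form (\<Phi> a) (\<Phi> b) (\<Phi> u))"
  have L: "?L x = \<Psi> ` octonionic_line (\<Phi> x)" for x
    using \<Phi>\<Psi> \<Psi>\<Phi> by (auto simp: image_iff) metis
  have "line_field ?L ?T 7"
  proof (rule line_field.intro)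
    show sub: "subspace (?L z)" for z
      unfolding L using linear_subspace_image[OF l\<Psi> subspace_octonionic_line] .
    show "z \<in> ?L z" for z by (simp add: mem_octonionic_line)
    show "?L (c *\<^sub>R z) = ?L z" if "c \<noteq> 0" for c z
      using that by (simp add: linear_cmul[OF lin] octonionic_line_scaleR)
    show "dim (?L z) = 7 + 1" if "z \<noteq> 0" for z
      unfolding L using dim_image_eq[OF l\<Psi>, of "octonionic_line (\<Phi> z)"] \<Phi>\<Psi>
      by (simp add: dim_octonionic_line inj_on_def) metis
    show "linear (?T a b)" for a b
      using linear_compose[OF linear_compose[OF lin octonionic_form_linear(1)] l\<Psi>] by (simp add: o_def)
    show "linear (\<lambda>a. ?T a b u)" for b u
      using linear_compose[OF linear_compose[OF lin octonionic_form_linear(2)] l\<Psi>] by (simp add: o_def)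
    show "?T a b u = ?T b a u" for a b u by (simp add: octonionic_form_commute)
    show "?T z z u \<bullet> u = ?T u u z \<bullet> z" for z u
      by (simp add: adj octonionic_form_reciprocal)
    show "?T z z u = (norm z)\<^sup>2 *\<^sub>R closest_point (?L z) u" for z u
    proof (cases "z = 0")
      case True
      have "octonionic_form 0 0 w = 0" for w using linear_0[OF octonionic_form_linear(2)] .
      thus ?thesis using True by (simp add: linear_0[OF lin] linear_0[OF l\<Psi>])
    next
      case False
      have "closest_point (?L z) u = (1 / (norm z)\<^sup>2) *\<^sub>R ?T z z u"
      proof (rule closest_point_subspace_eqI[OF sub])
        show "(1 / (norm z)\<^sup>2) *\<^sub>R ?T z z u \<in> ?L z"
          by (simp add: linear_cmul[OF lin] \<Phi>\<Psi> subspace_mul[OF subspace_octonionic_line octonionic_form_mem])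
        fix k assume "k \<in> ?L z"
        thus "(u - (1 / (norm z)\<^sup>2) *\<^sub>R ?T z z u) \<bullet> k = 0"
          using False by (simp add: inner_diff_left adj octonionic_form_orthogonal nrm inner)
      qed
      thus ?thesis using False by simp
    qed
  qed
  thus ?thesis using that g by blast
qed

section \<open>The Jacobian of the deformation\<close>

lemma det_scaleR:
  fixes A :: "real^'n^'n::finite"
  shows "det (c *\<^sub>R A) = c ^ CARD('n) * det A"
proof -
  have "c *\<^sub>R A = (\<chi> i. c *s A $ i)" by (simp add: vec_eq_iff)
  thus ?thesis by (simp add: det_rows_mul)
qed

lemma transpose_mult_vec_inner: "(transpose (A :: real^'n^'n::finite) *v a) \<bullet> b = a \<bullet> (A *v b)"
  by (simp add: dot_lmul_matrix)

lemma dir_deriv: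
  fixes x :: "real^'n::finite"
  assumes "x \<noteq> 0"
  shows "(dir has_derivative (\<lambda>h. (h - (dir x \<bullet> h) *\<^sub>R dir x) /\<^sub>R norm x)) (at x)"
proof -
  have n: "norm x \<noteq> 0" using assms by simp
  have "((\<lambda>z. norm z) has_derivative (\<lambda>h. dir x \<bullet> h)) (at x)"
    using has_derivative_norm[OF assms] by (simp add: dir_def sgn_div_norm inner_commute)
  from has_derivative_scaleR[OF Deriv.has_derivative_inverse[OF n this] has_derivative_ident]
  have "((\<lambda>z. inverse (norm z) *\<^sub>R z) has_derivative (\<lambda>h. (h - (dir x \<bullet> h) *\<^sub>R dir x) /\<^sub>R norm x)) (at x)"
    by (rule has_derivative_eq_rhs) (simp add: fun_eq_iff dir_def algebra_simps)
  thus ?thesis by (simp add: dir_def[abs_def])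
qed

lemma rad_deriv:
  fixes x :: "real^'n::finite"
  assumes "x \<in> ball 0 1 - {0}"
  shows "(rad has_derivative (\<lambda>h. (dir x \<bullet> h) / (1 - (norm x)\<^sup>2))) (at x)"
proof -
  have x: "x \<noteq> 0" "norm x < 1" using assms by auto
  have 1: "((\<lambda>z. norm z) has_derivative (\<lambda>h. dir x \<bullet> h)) (at x)"
    using has_derivative_norm[OF x(1)] by (simp add: dir_def sgn_div_norm inner_commute)
  have 2: "(artanh has_field_derivative (1 / (1 - (norm x)\<^sup>2))) (at (norm x))"
    by (rule artanh_real_has_field_derivative) (use x in auto)
  show ?thesis
    using DERIV_compose_FDERIV[OF 2 1] by (simp add: rad_def[abs_def])
qed

lemma polar_coordinates:
  fixes x :: "real^'n::finite"
  assumes "x \<in> ball 0 1 - {0}"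
  shows "norm (dir x) = 1" "0 < rad x" "norm x = tanh (rad x)" "x = tanh (rad x) *\<^sub>R dir x"
proof -
  have x: "x \<noteq> 0" "norm x < 1" using assms by auto
  show 1: "norm (dir x) = 1" using x by (simp add: dir_def)
  show 2: "x = tanh (rad x) *\<^sub>R dir x" using polar_rad_dir[OF assms] by (simp add: polar_def)
  have 3: "norm x = \<bar>tanh (rad x)\<bar>" using arg_cong[OF 2, of norm] 1 by simp
  have "1 < (1 + norm x) / (1 - norm x)" using x by (simp add: field_simps)
  thus 4: "0 < rad x" by (simp add: rad_def artanh_def)
  show "norm x = tanh (rad x)" using 3 4 by simp
qed

lemma one_minus_tanh_square: "1 - (tanh r)\<^sup>2 = 1 / (cosh (r::real))\<^sup>2"
proof -
  have c: "cosh r \<noteq> 0" using cosh_real_pos[of r] by simp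
  have "1 - (tanh r)\<^sup>2 = ((cosh r)\<^sup>2 - (sinh r)\<^sup>2) / (cosh r)\<^sup>2"
    using c by (simp add: tanh_def power_divide diff_divide_distrib)
  thus ?thesis by (simp add: cosh_square_eq)
qed

lemma radial_eq:
  "radial x = (1 / (cosh (rad x))\<^sup>2) *\<^sub>R dir (x :: real^'n::finite)"
  unfolding radial_def
proof (rule vector_derivative_at)
  have "cosh (rad x) \<noteq> 0" using cosh_real_pos[of "rad x"] by simp
  thus "((\<lambda>s. polar s (dir x)) has_vector_derivative (1 / (cosh (rad x))\<^sup>2) *\<^sub>R dir x) (at (rad x))"
    unfolding polar_def one_minus_tanh_square[symmetric] by (auto intro!: derivative_eq_intros)
qed

lemma frechet_derivative_polar:
  "frechet_derivative (polar r) (at \<theta>) = (\<lambda>u. tanh r *\<^sub>R u)"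
proof -
  have "(polar r has_derivative (\<lambda>u. tanh r *\<^sub>R u)) (at \<theta>)"
    unfolding polar_def by (auto intro!: derivative_eq_intros)
  thus ?thesis by (rule frechet_derivative_at[symmetric])
qed

text \<open>The factors \<open>1 / a(y)\<close> and \<open>a(y')\<close> are the derivatives of \<open>log_radius\<close> at the source and of its
  inverse \<open>r_of\<close> at the target; the vector \<open>h - (dir x \<bullet> h) dir x\<close> is the spherical part of \<open>h\<close>.\<close>
lemma deform_deriv:
  fixes x e0 :: "real^'n::finite" and \<kappa> t :: real and q :: nat
  assumes x: "x \<in> ball 0 1 - {0}"
  defines "y \<equiv> log_radius CARD('n) q (rad x)"
    and "\<phi> \<equiv> \<lambda>\<theta>. \<kappa> + \<theta> \<bullet> e0"
  defines "y' \<equiv> y + t * \<phi> (dir x)"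
  defines "\<rho> \<equiv> r_of CARD('n) q y'"
  shows "(deform q t \<phi> has_derivative
     (\<lambda>h. (tanh \<rho> / norm x) *\<^sub>R (h - (dir x \<bullet> h) *\<^sub>R dir x)
        + ((a_fun CARD('n) q y' / (cosh \<rho>)\<^sup>2)
            * ((dir x \<bullet> h) * (cosh (rad x))\<^sup>2 / a_fun CARD('n) q y
               + t / norm x * ((h - (dir x \<bullet> h) *\<^sub>R dir x) \<bullet> e0))) *\<^sub>R dir x)) (at x)"
proof -
  let ?n = "CARD('n)"
  have n: "?n \<ge> 1" by (simp add: Suc_leI)
  note pc = polar_coordinates[OF x]
  have x0: "x \<noteq> 0" using x by simp
  have 1: "((\<lambda>z. log_radius ?n q (rad z)) has_derivative (\<lambda>h. (dir x \<bullet> h) / (1 - (norm x)\<^sup>2) * (1 / a_fun ?n q y))) (at x)"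
    unfolding y_def by (rule DERIV_compose_FDERIV[OF log_radius_deriv_a_fun[OF n pc(2)] rad_deriv[OF x]])
  have 2: "((\<lambda>z. \<phi> (dir z)) has_derivative (\<lambda>h. ((h - (dir x \<bullet> h) *\<^sub>R dir x) /\<^sub>R norm x) \<bullet> e0)) (at x)"
    unfolding \<phi>_def by (auto intro!: derivative_eq_intros dir_deriv[OF x0])
  have 3: "((\<lambda>z. log_radius ?n q (rad z) + t * \<phi> (dir z)) has_derivative
      (\<lambda>h. (dir x \<bullet> h) / (1 - (norm x)\<^sup>2) * (1 / a_fun ?n q y) + t * (((h - (dir x \<bullet> h) *\<^sub>R dir x) /\<^sub>R norm x) \<bullet> e0))) (at x)"
    by (rule has_derivative_add[OF 1 has_derivative_mult_right[OF 2]])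
  have 4: "((\<lambda>y. tanh (r_of ?n q y)) has_field_derivative (1 / (cosh \<rho>)\<^sup>2) * a_fun ?n q y') (at y')"
  proof (rule DERIV_chain2[of tanh])
    show "(tanh has_field_derivative (1 / (cosh \<rho>)\<^sup>2)) (at (r_of ?n q y'))"
      using cosh_real_pos[of \<rho>] unfolding one_minus_tanh_square[symmetric] \<rho>_def
      by (auto intro!: derivative_eq_intros)
    show "(r_of ?n q has_field_derivative a_fun ?n q y') (at y')" by (rule r_of_deriv[OF n])
  qed
  have y': "y' = log_radius ?n q (rad x) + t * \<phi> (dir x)" by (simp add: y'_def y_def)
  note 5 = DERIV_compose_FDERIV[OF 4[unfolded y'] 3]
  have "deform q t \<phi> = (\<lambda>z. tanh (r_of ?n q (log_radius ?n q (rad z) + t * \<phi> (dir z))) *\<^sub>R dir z)"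
    by (simp add: fun_eq_iff deform_def polar_def)
  thus ?thesis
    using has_derivative_scaleR[OF 5 dir_deriv[OF x0]]
    apply (simp only:)
    apply (erule has_derivative_eq_rhs)
    apply (simp add: fun_eq_iff pc(3) one_minus_tanh_square flip: y')
    apply (simp add: \<rho>_def algebra_simps divide_inverse)
    done
qed

context line_field
begin

lemma orthonormal_basis_of_line:
  assumes "z \<noteq> 0"
  obtains B where "finite B" "pairwise orthogonal B" "\<forall>b\<in>B. norm b = 1" "card B = q + 1"
    "\<forall>u. P z u = (\<Sum>b\<in>B. (b \<bullet> u) *\<^sub>R b)"
proof -
  obtain B where B: "B \<subseteq> L z" "pairwise orthogonal B" "\<And>b. b \<in> B \<Longrightarrow> norm b = 1"
    "independent B" "card B = dim (L z)" "span B = L z"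
    using orthonormal_basis_subspace[OF subspace_L] by metis
  have fin: "finite B" using B(4) by (rule independent_imp_finite)
  have "P z u = (\<Sum>b\<in>B. (b \<bullet> u) *\<^sub>R b)" for u
  proof (rule closest_point_subspace_eqI[OF subspace_L])
    show "(\<Sum>b\<in>B. (b \<bullet> u) *\<^sub>R b) \<in> L z"
      using B(1) by (intro subspace_sum subspace_mul subspace_L) auto
    fix k assume "k \<in> L z"
    hence k: "k \<in> span B" using B(6) by simp
    have "orthogonal (u - (\<Sum>b\<in>B. (b \<bullet> u) *\<^sub>R b)) k"
    proof (rule orthogonal_to_span[OF k])
      fix c assume c: "c \<in> B"
      have "(\<Sum>b\<in>B. (b \<bullet> u) * (b \<bullet> c)) = (\<Sum>b\<in>B. if b = c then c \<bullet> u else 0)"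
        using B(2,3) c by (intro sum.cong) (auto simp: pairwise_def orthogonal_def norm_eq_1)
      thus "orthogonal (u - (\<Sum>b\<in>B. (b \<bullet> u) *\<^sub>R b)) c"
        using fin c by (simp add: orthogonal_def inner_diff_left inner_sum_left inner_commute[of u])
    qed
    thus "(u - (\<Sum>b\<in>B. (b \<bullet> u) *\<^sub>R b)) \<bullet> k = 0" by (simp add: orthogonal_def)
  qed
  thus ?thesis using that fin B dim_L[OF assms] by auto
qed

lemma det_gram:
  assumes z: "z \<noteq> 0" "norm z < 1"
  shows "det (gram g z) = (1 / (1 - (norm z)\<^sup>2)) ^ (CARD('n) + q + 1)"
proof -
  define s where "s = (norm z)\<^sup>2"
  have s: "1 - s \<noteq> 0" using z by (simp add: s_def power_less_one_iff less_imp_neq abs_square_eq_1)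
  obtain B where B: "finite B" "pairwise orthogonal B" "\<forall>b\<in>B. norm b = 1" "card B = q + 1"
    "\<forall>u. P z u = (\<Sum>b\<in>B. (b \<bullet> u) *\<^sub>R b)"
    using orthonormal_basis_of_line[OF z(1)] by blast
  define c where "c = s / (1 - s)"
  have "gram g z = (1 / (1 - s)) *\<^sub>R (mat 1 + (\<chi> i j. c * (\<Sum>b\<in>B. b $ i * b $ j)))" (is "_ = _ *\<^sub>R ?K")
  proof (rule matrix_eq[THEN iffD2], rule allI)
    fix u
    have "?K *v u = u + c *\<^sub>R P z u"
      unfolding matrix_vector_mult_add_rdistrib outer_product_sum_mult_vec B(5)[rule_format] by simp
    hence "((1 / (1 - s)) *\<^sub>R ?K) *v u = (1 / (1 - s)) *\<^sub>R (u + c *\<^sub>R P z u)"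
      by (simp only: scaleR_matrix_vector_assoc[symmetric])
    moreover have "1 / (1 - s) * c = 1 / (1 - s)\<^sup>2 * s" by (simp add: c_def power2_eq_square)
    ultimately show "gram g z *v u = ((1 / (1 - s)) *\<^sub>R ?K) *v u"
      by (simp only: gram_mult_vec gram_op_def T_diag s_def[symmetric] scaleR_add_right scaleR_scaleR)
  qed
  moreover have "1 + c = 1 / (1 - s)" using s by (simp add: c_def field_simps)
  ultimately show ?thesis
    by (simp add: det_scaleR det_projection_update B power_add s_def mult.assoc)
qed

text \<open>\<open>\<zeta> = A\<^sup>-\<^sup>T \<nu>\<close> is characterized by duality, which avoids computing any inverse matrix.\<close>
lemma metric_cof_eq:
  assumes x: "norm x < 1" and y: "norm y < 1" and A: "det A \<noteq> 0"
    and \<zeta>: "\<And>h. gram_op y \<zeta> \<bullet> (A *v h) = gram_op x \<nu> \<bullet> h"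
  shows "metric_cof g x y A *v \<nu> = metric_det g x y A *\<^sub>R \<zeta>"
proof -
  have adj: "metric_adjoint g x y A *v u = matrix_inv (gram g x) *v (transpose A *v gram_op y u)" for u
    by (simp only: metric_adjoint_def matrix_vector_mul_assoc[symmetric] gram_mult_vec)
  have "transpose A *v gram_op y \<zeta> = gram_op x \<nu>"
  proof (rule vector_eq_ldot[THEN iffD1], rule allI)
    show "h \<bullet> (transpose A *v gram_op y \<zeta>) = h \<bullet> gram_op x \<nu>" for h
      using \<zeta>[of h] transpose_mult_vec_inner[of A "gram_op y \<zeta>" h] by (simp only: inner_commute[of h])
  qed
  moreover have "matrix_inv (gram g x) *v gram_op x \<nu> = \<nu>"
    by (rule matrix_inv_mult_vec_eqI[OF invertible_gram[OF x] gram_mult_vec])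
  ultimately have 1: "metric_adjoint g x y A *v \<zeta> = \<nu>" by (simp only: adj)
  have "invertible (metric_adjoint g x y A)"
  proof (rule invertible_if_inj_mult_vec)
    fix u assume "metric_adjoint g x y A *v u = 0"
    hence "gram g x *v (matrix_inv (gram g x) *v (transpose A *v gram_op y u)) = 0" by (simp only: adj) simp
    hence "transpose A *v gram_op y u = 0" by (simp only: gram_mult_vec matrix_inv_gram[OF x] gram_op_inverse[OF x])
    hence "gram_op y u \<bullet> (A *v h) = 0" for h using transpose_mult_vec_inner[of A "gram_op y u" h] by simp
    moreover have "invertible A" using A by (simp add: invertible_det_nz)
    then obtain A' where "A ** A' = mat 1" by (auto simp: invertible_def)
    hence "A *v (A' *v w) = w" for w by (simp add: matrix_vector_mul_assoc)
    ultimately have "gram_op y u \<bullet> w = 0" for w by metis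
    hence "gram_op y u = 0" by (metis inner_eq_zero_iff)
    thus "u = 0" by (rule gram_op_eq_0[OF y])
  qed
  hence "matrix_inv (metric_adjoint g x y A) *v \<nu> = \<zeta>" using 1 by (rule matrix_inv_mult_vec_eqI)
  thus ?thesis by (simp add: metric_cof_def scaleR_matrix_vector_assoc[symmetric])
qed

text \<open>Along the ray through \<open>\<theta>\<close> the metric at distance \<open>r\<close> scales Euclidean lengths by \<open>cosh\<^sup>2 r\<close> on the
  line of \<open>\<theta>\<close> and by \<open>cosh r\<close> on its orthogonal complement; the two corollaries are used in this form.\<close>
lemma gram_op_polar:
  assumes "norm \<theta> = 1" "r \<noteq> 0"
  shows "gram_op (tanh r *\<^sub>R \<theta>) u = (cosh r)\<^sup>2 *\<^sub>R u + ((cosh r)\<^sup>2 * (sinh r)\<^sup>2) *\<^sub>R P \<theta> u"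
proof -
  have c: "cosh r \<noteq> 0" using cosh_real_pos[of r] by simp
  have "P (tanh r *\<^sub>R \<theta>) u = P \<theta> u" using assms L_scaleR[of "tanh r" \<theta>] by simp
  moreover have "(norm (tanh r *\<^sub>R \<theta>))\<^sup>2 = (tanh r)\<^sup>2" using assms by simp
  moreover have "1 / (1 / (cosh r)\<^sup>2)\<^sup>2 * (tanh r)\<^sup>2 = (cosh r)\<^sup>2 * (sinh r)\<^sup>2"
    using c by (simp add: tanh_def field_simps power2_eq_square)
  ultimately show ?thesis
    by (simp only: gram_op_def T_diag one_minus_tanh_square scaleR_scaleR) simp
qed

lemma gram_op_polar_line:
  assumes "norm \<theta> = 1" "r \<noteq> 0" and u: "P \<theta> u = u"
  shows "gram_op (tanh r *\<^sub>R \<theta>) u = cosh r ^ 4 *\<^sub>R u"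
proof -
  have "(cosh r)\<^sup>2 + (cosh r)\<^sup>2 * (sinh r)\<^sup>2 = (cosh r)\<^sup>2 * ((sinh r)\<^sup>2 + 1)"
    by (simp add: algebra_simps)
  also have "\<dots> = cosh r ^ 4" by (simp only: cosh_square_eq[symmetric]) (simp flip: power_add)
  finally show ?thesis
    unfolding gram_op_polar[OF assms(1,2)] u scaleR_add_left[symmetric] by (simp only:)
qed

lemma gram_op_polar_orthogonal:
  assumes "norm \<theta> = 1" "r \<noteq> 0" and u: "P \<theta> u = 0"
  shows "gram_op (tanh r *\<^sub>R \<theta>) u = (cosh r)\<^sup>2 *\<^sub>R u"
  unfolding gram_op_polar[OF assms(1,2)] u by simp

lemma det_gram_polar:
  assumes "norm \<theta> = 1" "0 < r"
  shows "sqrt (det (gram g (tanh r *\<^sub>R \<theta>))) = cosh r ^ (CARD('n) + q + 1)"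
proof -
  have z: "tanh r *\<^sub>R \<theta> \<noteq> 0" "norm (tanh r *\<^sub>R \<theta>) < 1"
    using assms tanh_real_lt_1[of r] tanh_real_pos_iff[of r] by auto
  have n: "(norm (tanh r *\<^sub>R \<theta>))\<^sup>2 = (tanh r)\<^sup>2" using assms by simp
  have "det (gram g (tanh r *\<^sub>R \<theta>)) = (cosh r ^ (CARD('n) + q + 1))\<^sup>2"
    unfolding det_gram[OF z] n one_minus_tanh_square
    by (simp add: power_one_over power_mult[symmetric] mult.commute del: power_Suc)
  thus ?thesis by simp
qed

text \<open>The data \<open>\<kappa> + \<theta> \<bullet> e0\<close> cover the constant function and the linear functions at once. The vectors
  \<open>e\<^sub>H\<close> and \<open>e\<^sub>V\<close> are the components of the gradient of \<open>\<theta> \<mapsto> \<theta> \<bullet> e0\<close> on the unit sphere.\<close>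
lemma Jac_eq:
  fixes x \<nu> v w e0 :: "real^'n" and \<kappa> t \<alpha> :: real
  assumes x: "x \<in> ball 0 1 - {0}" and n: "CARD('n) = p + q + 1"
    and v: "P (dir x) v = 0" and w: "P (dir x) w = w" "w \<bullet> dir x = 0"
    and \<nu>: "\<nu> = \<alpha> *\<^sub>R radial x + v + w"
  defines "a \<equiv> a_fun CARD('n) q" and "b \<equiv> b_fun CARD('n) q" and "c \<equiv> c_fun CARD('n) q"
    and "y \<equiv> log_radius CARD('n) q (rad x)"
    and "s \<equiv> \<kappa> + dir x \<bullet> e0"
    and "e\<^sub>H \<equiv> e0 - P (dir x) e0" and "e\<^sub>V \<equiv> P (dir x) e0 - (dir x \<bullet> e0) *\<^sub>R dir x"
  shows "Jac g q x \<nu> t (\<lambda>\<theta>. \<kappa> + \<theta> \<bullet> e0) = exp (real CARD('n) * t * s) *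
    sqrt (\<alpha>\<^sup>2 * (a y / a (y + t * s))\<^sup>2
      + (b y / b (y + t * s))\<^sup>2 * (norm (cosh (rad x) *\<^sub>R v - (\<alpha> * t * (a y / b y)) *\<^sub>R e\<^sub>H))\<^sup>2
      + (c y / c (y + t * s))\<^sup>2 * (norm ((cosh (rad x))\<^sup>2 *\<^sub>R w - (\<alpha> * t * (a y / c y)) *\<^sub>R e\<^sub>V))\<^sup>2)"
proof -
  let ?n = "CARD('n)"
  define \<theta> r where "\<theta> = dir x" and "r = rad x"
  define y' where "y' = y + t * s"
  define \<rho> where "\<rho> = r_of ?n q y'"
  define S C S' C' where "S = sinh r" and "C = cosh r" and "S' = sinh \<rho>" and "C' = cosh \<rho>"
  define A0 A1 where "A0 = a y" and "A1 = a y'"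
  define F where "F = deform q t (\<lambda>\<theta>. \<kappa> + \<theta> \<bullet> e0)"
  have n1: "?n \<ge> 1" by (simp add: Suc_leI)
  have pc: "norm \<theta> = 1" "0 < r" "norm x = tanh r" "x = tanh r *\<^sub>R \<theta>"
    unfolding \<theta>_def r_def by (rule polar_coordinates[OF x])+
  have \<rho>: "0 < \<rho>" unfolding \<rho>_def by (rule r_of_pos[OF n1])
  have pos: "0 < S" "0 < C" "0 < S'" "0 < C'" "0 < A0" "0 < A1"
    using pc(2) \<rho> a_fun_pos[OF n1] by (simp_all add: S_def C_def S'_def C'_def A0_def A1_def a_def)
  have ry: "r_of ?n q y = r" unfolding y_def r_def by (rule r_of_log_radius[OF n1 pc(2)[unfolded r_def]])
  have bc: "b y = S" "c y = S * C" "b y' = S'" "c y' = S' * C'"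
    by (simp_all add: b_def c_def b_fun_def c_fun_def ry S_def C_def S'_def C'_def \<rho>_def[symmetric])
  have th: "tanh r = S / C" "tanh \<rho> = S' / C'" by (simp_all add: tanh_def S_def C_def S'_def C'_def)
  have Fx: "F x = tanh \<rho> *\<^sub>R \<theta>"
    by (simp add: F_def deform_def polar_def \<rho>_def y'_def y_def s_def \<theta>_def)
  have nF: "norm (F x) < 1" using pc(1) \<rho> tanh_real_lt_1[of \<rho>] by (simp add: Fx)
  have nx: "norm x < 1" using x by simp
  \<comment> \<open>In Euclidean terms the differential scales the complement of \<open>\<theta>\<close> by \<open>\<mu>\<close> and \<open>\<theta>\<close> by \<open>\<omega>\<close>, and \<open>\<sigma>\<close> is
    the size of the shear into the direction \<open>\<theta>\<close>.\<close>
  define \<mu> \<omega> \<sigma> where "\<mu> = S' * C / (C' * S)" and "\<omega> = A1 * C\<^sup>2 / (C'\<^sup>2 * A0)"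
    and "\<sigma> = A1 * t * C / (C'\<^sup>2 * S)"
  have \<mu>: "\<mu> > 0" using pos by (simp add: \<mu>_def)
  define A where "A = jacobian F (at x)"
  have A: "A *v h = \<mu> *\<^sub>R (h - (\<theta> \<bullet> h) *\<^sub>R \<theta>) + (\<omega> * (\<theta> \<bullet> h) + \<sigma> * ((h - (\<theta> \<bullet> h) *\<^sub>R \<theta>) \<bullet> e0)) *\<^sub>R \<theta>" for h
  proof -
    note d = deform_deriv[OF x, of q t \<kappa> e0, folded y_def s_def F_def, folded y'_def, folded \<rho>_def]
    have "(\<lambda>h. A *v h) = frechet_derivative F (at x)"
      using jacobian_works[of F "at x"] differentiableI[OF d] frechet_derivative_at A_def by metis
    hence "A *v h = frechet_derivative F (at x) h" by (rule fun_cong)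
    also have "\<dots> = (tanh \<rho> / norm x) *\<^sub>R (h - (dir x \<bullet> h) *\<^sub>R dir x)
        + ((a_fun ?n q y' / (cosh \<rho>)\<^sup>2)
            * ((dir x \<bullet> h) * (cosh (rad x))\<^sup>2 / a_fun ?n q y
               + t / norm x * ((h - (dir x \<bullet> h) *\<^sub>R dir x) \<bullet> e0))) *\<^sub>R dir x"
      by (rule frechet_derivative_at[OF d, symmetric, THEN fun_cong])
    finally show ?thesis
      unfolding pc(3) th \<theta>_def[symmetric] r_def[symmetric] a_def[symmetric] A0_def[symmetric] A1_def[symmetric]
        C_def[symmetric] C'_def[symmetric]
      by (simp add: \<mu>_def \<omega>_def \<sigma>_def distrib_left mult_ac)
  qed
  have t1: "\<theta> \<bullet> \<theta> = 1" using pc(1) by (simp add: norm_eq_1)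
  have detA: "det A = \<mu> ^ ?n * (\<omega> / \<mu>)"
  proof -
    define V where "V = (1 / \<mu>) *\<^sub>R ((\<omega> - \<mu>) *\<^sub>R \<theta> + \<sigma> *\<^sub>R (e0 - (\<theta> \<bullet> e0) *\<^sub>R \<theta>))"
    have "A = \<mu> *\<^sub>R (mat 1 + (\<chi> i j. \<theta> $ i * V $ j))"
    proof (rule matrix_eq[THEN iffD2], rule allI)
      fix h
      have "(\<mu> *\<^sub>R (mat 1 + (\<chi> i j. \<theta> $ i * V $ j))) *v h = \<mu> *\<^sub>R h + (\<mu> * (V \<bullet> h)) *\<^sub>R \<theta>"
        unfolding scaleR_matrix_vector_assoc[symmetric] matrix_vector_mult_add_rdistrib outer_product_mult_vec
        by (simp add: scaleR_add_right)
      also have "\<mu> * (V \<bullet> h) = (\<omega> - \<mu>) * (\<theta> \<bullet> h) + \<sigma> * ((h - (\<theta> \<bullet> h) *\<^sub>R \<theta>) \<bullet> e0)"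
        using \<mu> by (simp add: V_def inner_add_left inner_diff_left inner_commute[of e0] mult.commute)
      finally show "A *v h = (\<mu> *\<^sub>R (mat 1 + (\<chi> i j. \<theta> $ i * V $ j))) *v h"
        by (simp add: A algebra_simps)
    qed
    hence "det A = \<mu> ^ ?n * (1 + \<theta> \<bullet> V)" by (simp only: det_scaleR det_rank_one_update)
    also have "1 + \<theta> \<bullet> V = \<omega> / \<mu>"
      using \<mu> by (simp add: V_def inner_add_right inner_diff_right t1 field_simps)
    finally show ?thesis .
  qed
  have "\<omega> \<noteq> 0" using pos by (simp add: \<omega>_def)
  hence detA0: "det A \<noteq> 0" using \<mu> by (simp add: detA)
  have mdet: "metric_det g x (F x) A = exp (real ?n * t * s)"
  proof -
    have "metric_det g x (F x) A = \<mu> ^ ?n * (\<omega> / \<mu>) * C' ^ (?n + q + 1) / C ^ (?n + q + 1)"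
      unfolding metric_det_def detA Fx det_gram_polar[OF pc(1) \<rho>] C'_def C_def
      by (subst pc(4)) (simp only: det_gram_polar[OF pc(1,2)])
    also have "\<dots> = (A1 * S' ^ p * (S' * C') ^ q) / (A0 * S ^ p * (S * C) ^ q)"
      unfolding n \<mu>_def \<omega>_def using pos
      by (simp add: field_simps power_add power_mult_distrib power_divide power2_eq_square)
    also have "\<dots> = exp (real ?n * y') / exp (real ?n * y)"
      using volume_density[OF n, of y] volume_density[OF n, of y']
      by (simp add: A0_def A1_def a_def b_def[symmetric] c_def[symmetric] bc)
    also have "\<dots> = exp (real ?n * t * s)"
      by (simp add: exp_diff[symmetric] y'_def algebra_simps)
    finally show ?thesis .
  qed
  have P\<theta>: "P \<theta> \<theta> = \<theta>" by (rule P_self[OF mem_L])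
  define f\<^sub>H f\<^sub>V where "f\<^sub>H = C *\<^sub>R v - (\<alpha> * t * (A0 / S)) *\<^sub>R e\<^sub>H"
    and "f\<^sub>V = C\<^sup>2 *\<^sub>R w - (\<alpha> * t * (A0 / (S * C))) *\<^sub>R e\<^sub>V"
  have PH: "P \<theta> f\<^sub>H = 0" and PV: "P \<theta> f\<^sub>V = f\<^sub>V"
    using v w by (simp_all add: f\<^sub>H_def f\<^sub>V_def e\<^sub>H_def e\<^sub>V_def \<theta>_def[symmetric] P_idem P\<theta>
        linear_diff[OF linear_P] linear_cmul[OF linear_P])
  have H\<theta>: "\<theta> \<bullet> f\<^sub>H = 0" using P_inner_commute[of \<theta> \<theta> f\<^sub>H] by (simp add: PH P\<theta>)
  have V\<theta>: "\<theta> \<bullet> f\<^sub>V = 0"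
    using w(2) P_inner_commute[of \<theta> \<theta> e0]
    by (simp add: f\<^sub>V_def e\<^sub>V_def \<theta>_def[symmetric] inner_diff_right P\<theta> t1 inner_commute)
  have HV: "f\<^sub>H \<bullet> f\<^sub>V = 0" using P_inner_commute[of \<theta> f\<^sub>H f\<^sub>V] by (simp add: PH PV)
  \<comment> \<open>The candidate for the inverse transpose applied to \<open>\<nu>\<close>, read off from the triangular matrix; the
    denominators \<open>C'\<close> and \<open>C'\<^sup>2\<close> convert Euclidean unit vectors into unit vectors at \<open>F x\<close>.\<close>
  define \<zeta> where "\<zeta> = (\<alpha> * (A0 / A1) / C'\<^sup>2) *\<^sub>R \<theta> + (S / S' / C') *\<^sub>R f\<^sub>H + (S * C / (S' * C') / C'\<^sup>2) *\<^sub>R f\<^sub>V"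
  have G\<zeta>: "gram_op (F x) \<zeta> = (\<alpha> * (A0 / A1) * C'\<^sup>2) *\<^sub>R \<theta> + (C' * S / S') *\<^sub>R f\<^sub>H + (S * C * C' / S') *\<^sub>R f\<^sub>V"
  proof -
    note par = gram_op_polar_line[OF pc(1) less_imp_neq[OF \<rho>, symmetric], folded Fx C'_def]
    note orth = gram_op_polar_orthogonal[OF pc(1) less_imp_neq[OF \<rho>, symmetric], folded Fx C'_def]
    show ?thesis
      unfolding \<zeta>_def linear_add[OF linear_gram_op] linear_cmul[OF linear_gram_op] par[OF P\<theta>] par[OF PV] orth[OF PH] scaleR_scaleR
      using pos by (simp add: power2_eq_square power4_eq_xxxx mult_ac)
  qed
  have G\<nu>: "gram_op x \<nu> = (\<alpha> * C\<^sup>2) *\<^sub>R \<theta> + C\<^sup>2 *\<^sub>R v + C ^ 4 *\<^sub>R w"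
  proof -
    have rad: "radial x = (1 / C\<^sup>2) *\<^sub>R \<theta>" by (simp add: radial_eq C_def r_def \<theta>_def)
    note par = gram_op_polar_line[OF pc(1) less_imp_neq[OF pc(2), symmetric], folded pc(4) C_def]
    note orth = gram_op_polar_orthogonal[OF pc(1) less_imp_neq[OF pc(2), symmetric], folded pc(4) C_def]
    show ?thesis
      unfolding \<nu> rad linear_add[OF linear_gram_op] linear_cmul[OF linear_gram_op] par[OF P\<theta>]
        par[OF w(1)[folded \<theta>_def]] orth[OF v[folded \<theta>_def]] scaleR_scaleR
      using pos by (simp add: power2_eq_square power4_eq_xxxx mult_ac)
  qed
  have "gram_op (F x) \<zeta> \<bullet> (A *v h) = gram_op x \<nu> \<bullet> h" for h
  proof -
    have i1: "\<theta> \<bullet> (A *v h) = \<omega> * (\<theta> \<bullet> h) + \<sigma> * ((h - (\<theta> \<bullet> h) *\<^sub>R \<theta>) \<bullet> e0)"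
      by (simp add: A inner_add_right inner_diff_right t1)
    have i2: "f\<^sub>H \<bullet> (A *v h) = \<mu> * (f\<^sub>H \<bullet> h)" "f\<^sub>V \<bullet> (A *v h) = \<mu> * (f\<^sub>V \<bullet> h)"
      using H\<theta> V\<theta> by (simp_all add: A inner_add_right inner_diff_right inner_commute[of _ \<theta>])
    have i3: "(h - (\<theta> \<bullet> h) *\<^sub>R \<theta>) \<bullet> e0 = e\<^sub>H \<bullet> h + e\<^sub>V \<bullet> h"
      by (simp add: e\<^sub>H_def e\<^sub>V_def \<theta>_def[symmetric] inner_diff_left inner_diff_right inner_commute)
    have k: "\<alpha> * (A0 / A1) * C'\<^sup>2 * \<omega> = \<alpha> * C\<^sup>2" "\<alpha> * (A0 / A1) * C'\<^sup>2 * \<sigma> = \<alpha> * t * A0 * C / S"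
      "C' * S / S' * \<mu> = C" "S * C * C' / S' * \<mu> = C\<^sup>2"
      using pos by (simp_all add: \<omega>_def \<sigma>_def \<mu>_def power2_eq_square)
    have "gram_op (F x) \<zeta> \<bullet> (A *v h) = (\<alpha> * (A0 / A1) * C'\<^sup>2 * \<omega>) * (\<theta> \<bullet> h) + (\<alpha> * (A0 / A1) * C'\<^sup>2 * \<sigma>) * (e\<^sub>H \<bullet> h + e\<^sub>V \<bullet> h)
       + (C' * S / S' * \<mu>) * (f\<^sub>H \<bullet> h) + (S * C * C' / S' * \<mu>) * (f\<^sub>V \<bullet> h)"
      unfolding G\<zeta> inner_add_left inner_scaleR_left i1 i2 i3 by (simp add: distrib_left mult.assoc)
    also have "\<dots> = gram_op x \<nu> \<bullet> h"
      unfolding k G\<nu> f\<^sub>H_def f\<^sub>V_def inner_add_left inner_diff_left inner_scaleR_left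
      using pos by (simp add: field_simps power2_eq_square power4_eq_xxxx)
    finally show ?thesis .
  qed
  hence cof: "metric_cof g x (F x) A *v \<nu> = exp (real ?n * t * s) *\<^sub>R \<zeta>"
    using metric_cof_eq[OF nx nF detA0] mdet by metis
  have g\<zeta>: "g (F x) \<zeta> \<zeta> = \<alpha>\<^sup>2 * (A0 / A1)\<^sup>2 + (S / S')\<^sup>2 * (norm f\<^sub>H)\<^sup>2 + (S * C / (S' * C'))\<^sup>2 * (norm f\<^sub>V)\<^sup>2"
  proof -
    have i: "(k1 *\<^sub>R \<theta> + k2 *\<^sub>R f\<^sub>H + k3 *\<^sub>R f\<^sub>V) \<bullet> (l1 *\<^sub>R \<theta> + l2 *\<^sub>R f\<^sub>H + l3 *\<^sub>R f\<^sub>V)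
        = k1 * l1 + k2 * l2 * (norm f\<^sub>H)\<^sup>2 + k3 * l3 * (norm f\<^sub>V)\<^sup>2" for k1 k2 k3 l1 l2 l3
      using H\<theta> V\<theta> HV
      by (simp add: inner_add_left inner_add_right t1 inner_commute[of f\<^sub>H \<theta>] inner_commute[of f\<^sub>V \<theta>]
          inner_commute[of f\<^sub>V f\<^sub>H] power2_norm_eq_inner)
    have "\<alpha> * (A0 / A1) * C'\<^sup>2 * (\<alpha> * (A0 / A1) / C'\<^sup>2) = \<alpha>\<^sup>2 * (A0 / A1)\<^sup>2"
      "C' * S / S' * (S / S' / C') = (S / S')\<^sup>2"
      "S * C * C' / S' * (S * C / (S' * C') / C'\<^sup>2) = (S * C / (S' * C'))\<^sup>2"
      using pos by (simp_all add: power2_eq_square mult_ac)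
    thus ?thesis unfolding metric_eq_inner_gram_op G\<zeta> unfolding \<zeta>_def i by (simp only:)
  qed
  have "Jac g q x \<nu> t (\<lambda>\<theta>. \<kappa> + \<theta> \<bullet> e0) = sqrt (g (F x) (exp (real ?n * t * s) *\<^sub>R \<zeta>) (exp (real ?n * t * s) *\<^sub>R \<zeta>))"
    by (simp add: Jac_def Let_def metric_norm_def F_def[symmetric] A_def[symmetric] cof)
  also have "\<dots> = exp (real ?n * t * s) * sqrt (g (F x) \<zeta> \<zeta>)"
    by (simp add: metric_eq_inner_gram_op linear_cmul[OF linear_gram_op] real_sqrt_mult)
  finally show ?thesis
    unfolding g\<zeta> f\<^sub>H_def f\<^sub>V_def A0_def A1_def y'_def[symmetric] bc r_def[symmetric] C_def[symmetric] .
qed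

end

section \<open>The second variation\<close>

text \<open>Only the value, the first and the second derivative of \<open>E\<close> at 0 enter, but \<open>deriv\<close> of the first
  derivative needs the formula for it in a neighbourhood of 0, where \<open>E\<close> is positive.\<close>
lemma second_order_exp_sqrt:
  fixes E :: "real \<Rightarrow> real"
  assumes E: "\<And>t. (E has_real_derivative E' t) (at t)" "(E' has_real_derivative E'') (at 0)" "E 0 = 1"
  shows "deriv (\<lambda>t. exp (k * t) * sqrt (E t)) 0 = k + E' 0 / 2"
    and "(deriv ^^ 2) (\<lambda>t. exp (k * t) * sqrt (E t)) 0 = k\<^sup>2 + k * E' 0 + E'' / 2 - (E' 0)\<^sup>2 / 4"
proof -
  let ?J = "\<lambda>t. exp (k * t) * sqrt (E t)"
  let ?J' = "\<lambda>t. exp (k * t) * (k * sqrt (E t) + E' t / (2 * sqrt (E t)))"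
  have "isCont E 0" using E(1) by (rule DERIV_isCont)
  hence "(E \<longlongrightarrow> E 0) (nhds 0)" by (simp add: isCont_def tendsto_at_iff_tendsto_nhds)
  hence "\<forall>\<^sub>F t in nhds 0. E t > 0" by (rule order_tendstoD(1)) (simp add: E(3))
  moreover have J: "(?J has_real_derivative ?J' t) (at t)" if "E t > 0" for t
    using that by (auto intro!: derivative_eq_intros E(1) simp: field_simps)
  ultimately have ev: "\<forall>\<^sub>F t in nhds 0. deriv ?J t = ?J' t"
    by (auto elim!: eventually_mono intro: DERIV_imp_deriv)
  have J0: "(?J has_real_derivative ?J' 0) (at 0)" using E(3) by (intro J) simp
  show "deriv ?J 0 = k + E' 0 / 2" using DERIV_imp_deriv[OF J0] E(3) by simp
  have "(?J' has_real_derivative k\<^sup>2 + k * E' 0 + E'' / 2 - (E' 0)\<^sup>2 / 4) (at 0)"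
    using E(3) by (auto intro!: derivative_eq_intros E(1,2) simp: field_simps power2_eq_square)
  from DERIV_imp_deriv[OF this]
  have "deriv (deriv ?J) 0 = k\<^sup>2 + k * E' 0 + E'' / 2 - (E' 0)\<^sup>2 / 4"
    unfolding deriv_cong_ev[OF ev refl] .
  thus "(deriv ^^ 2) ?J 0 = k\<^sup>2 + k * E' 0 + E'' / 2 - (E' 0)\<^sup>2 / 4"
    by (simp add: numeral_2_eq_2)
qed

text \<open>One summand under the square root: \<open>(f(y) / f(y + t s))\<^sup>2\<close> for \<open>X = ln f\<close>, times the squared length of a
  vector that is affine in \<open>t\<close>.\<close>
lemma weighted_square_deriv:
  fixes X :: "real \<Rightarrow> real" and y s x0 x1 x2 :: real
  assumes X: "twice_differentiable X"
  defines "f \<equiv> \<lambda>t. exp (2 * (X y - X (y + t * s))) * (x0 - 2 * x1 * t + x2 * t\<^sup>2)"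
    and "f' \<equiv> \<lambda>t. exp (2 * (X y - X (y + t * s))) *
       (- 2 * s * deriv X (y + t * s) * (x0 - 2 * x1 * t + x2 * t\<^sup>2) + (- 2 * x1 + 2 * x2 * t))"
  shows "(f has_real_derivative f' t) (at t)"
    and "(f' has_real_derivative
           x0 * s\<^sup>2 * (4 * (deriv X y)\<^sup>2 - 2 * (deriv ^^ 2) X y) + 2 * x2 + 8 * s * deriv X y * x1) (at 0)"
proof -
  have X1: "((\<lambda>t. X (y + t * s)) has_real_derivative deriv X (y + t * s) * s) (at t)" for t
    using X unfolding twice_differentiable_def by (auto intro!: DERIV_chain2[of X] derivative_eq_intros)
  have X2: "((\<lambda>t. deriv X (y + t * s)) has_real_derivative (deriv ^^ 2) X (y + t * s) * s) (at t)" for t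
    using X unfolding twice_differentiable_def by (auto intro!: DERIV_chain2[of "deriv X"] derivative_eq_intros)
  show "(f has_real_derivative f' t) (at t)"
    unfolding f_def f'_def
    by (auto intro!: derivative_eq_intros X1 simp: algebra_simps)
  have "(f' has_real_derivative
           x0 * s\<^sup>2 * (4 * (deriv X (y + 0 * s))\<^sup>2 - 2 * (deriv ^^ 2) X (y + 0 * s)) + 2 * x2 + 8 * s * deriv X (y + 0 * s) * x1) (at 0)"
    unfolding f'_def
    by (rule derivative_eq_intros X1 X2 refl)+ (simp add: algebra_simps power2_eq_square)
  thus "(f' has_real_derivative
           x0 * s\<^sup>2 * (4 * (deriv X y)\<^sup>2 - 2 * (deriv ^^ 2) X y) + 2 * x2 + 8 * s * deriv X y * x1) (at 0)"
    by simp
qed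

text \<open>The expansion of the Jacobian as a statement about real functions: \<open>a0, b0, c0\<close> are the squared lengths
  of the three components of \<open>\<nu>\<close>, \<open>b1, c1\<close> their inner products with the components of the scaled gradient,
  and \<open>b2, c2\<close> the squared lengths of the latter. The radial component is not affected by the gradient.\<close>
lemma second_order_Jacobian:
  fixes A B C :: "real \<Rightarrow> real" and \<phi> :: real
  assumes td: "twice_differentiable A" "twice_differentiable B" "twice_differentiable C"
    and sum: "a0 + b0 + c0 = 1"
    and J: "\<And>t. J t = exp (n * t * s) * sqrt (a0 * exp (2 * (A y - A (y + t * s)))
        + exp (2 * (B y - B (y + t * s))) * (b0 - 2 * b1 * t + b2 * t\<^sup>2)
        + exp (2 * (C y - C (y + t * s))) * (c0 - 2 * c1 * t + c2 * t\<^sup>2))"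
    and Z: "Z = deriv A y * a0 + deriv B y * b0 + deriv C y * c0"
  shows "deriv J 0 = n * s - s * Z - (b1 + c1)"
    and "(deriv ^^ 2) J 0 = n\<^sup>2 * s\<^sup>2 - 2 * n * s * (s * Z + (b1 + c1)) - (s * Z + (b1 + c1))\<^sup>2
      + s\<^sup>2 * (a0 * (2 * (deriv A y)\<^sup>2 - (deriv ^^ 2) A y) + b0 * (2 * (deriv B y)\<^sup>2 - (deriv ^^ 2) B y)
              + c0 * (2 * (deriv C y)\<^sup>2 - (deriv ^^ 2) C y))
      + b2 + c2 + 4 * s * (deriv B y * b1 + deriv C y * c1)"
proof -
  define fA where "fA = (\<lambda>t. exp (2 * (A y - A (y + t * s))) * (a0 - 2 * 0 * t + 0 * t\<^sup>2))"
  define fB where "fB = (\<lambda>t. exp (2 * (B y - B (y + t * s))) * (b0 - 2 * b1 * t + b2 * t\<^sup>2))"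
  define fC where "fC = (\<lambda>t. exp (2 * (C y - C (y + t * s))) * (c0 - 2 * c1 * t + c2 * t\<^sup>2))"
  define gA where "gA = (\<lambda>t. exp (2 * (A y - A (y + t * s))) *
       (- 2 * s * deriv A (y + t * s) * (a0 - 2 * 0 * t + 0 * t\<^sup>2) + (- 2 * 0 + 2 * 0 * t)))"
  define gB where "gB = (\<lambda>t. exp (2 * (B y - B (y + t * s))) *
       (- 2 * s * deriv B (y + t * s) * (b0 - 2 * b1 * t + b2 * t\<^sup>2) + (- 2 * b1 + 2 * b2 * t)))"
  define gC where "gC = (\<lambda>t. exp (2 * (C y - C (y + t * s))) *
       (- 2 * s * deriv C (y + t * s) * (c0 - 2 * c1 * t + c2 * t\<^sup>2) + (- 2 * c1 + 2 * c2 * t)))"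
  have d: "(fA has_real_derivative gA t) (at t)" "(fB has_real_derivative gB t) (at t)"
    "(fC has_real_derivative gC t) (at t)" for t
    unfolding fA_def gA_def fB_def gB_def fC_def gC_def
    by (rule weighted_square_deriv(1)[OF td(1)] weighted_square_deriv(1)[OF td(2)]
        weighted_square_deriv(1)[OF td(3)])+
  note d2 = weighted_square_deriv(2)[OF td(1), of y s a0 0 0, folded gA_def]
    weighted_square_deriv(2)[OF td(2), of y s b0 b1 b2, folded gB_def]
    weighted_square_deriv(2)[OF td(3), of y s c0 c1 c2, folded gC_def]
  let ?E = "\<lambda>t. fA t + fB t + fC t"
  let ?E' = "\<lambda>t. gA t + gB t + gC t"
  have 1: "(?E has_real_derivative ?E' t) (at t)" for t
    by (intro DERIV_add d)
  note 2 = DERIV_add[OF DERIV_add[OF d2(1) d2(2)] d2(3)]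
  have 3: "?E 0 = 1" using sum by (simp add: fA_def fB_def fC_def)
  have 4: "?E' 0 = - 2 * (s * Z + (b1 + c1))" by (simp add: gA_def gB_def gC_def Z algebra_simps)
  have JE: "J = (\<lambda>t. exp ((n * s) * t) * sqrt (?E t))"
    by (simp add: fun_eq_iff J fA_def fB_def fC_def mult_ac)
  note r = second_order_exp_sqrt[OF 1 2 3, of "n * s", folded JE, unfolded 4]
  show "deriv J 0 = n * s - s * Z - (b1 + c1)" using r(1) by (simp add: field_simps)
  show "(deriv ^^ 2) J 0 = n\<^sup>2 * s\<^sup>2 - 2 * n * s * (s * Z + (b1 + c1)) - (s * Z + (b1 + c1))\<^sup>2
      + s\<^sup>2 * (a0 * (2 * (deriv A y)\<^sup>2 - (deriv ^^ 2) A y) + b0 * (2 * (deriv B y)\<^sup>2 - (deriv ^^ 2) B y)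
              + c0 * (2 * (deriv C y)\<^sup>2 - (deriv ^^ 2) C y))
      + b2 + c2 + 4 * s * (deriv B y * b1 + deriv C y * c1)"
    unfolding r(2) by (simp add: field_simps power2_eq_square)
qed

text \<open>Orthonormality of the rows of a square matrix implies that of its columns.\<close>
lemma orthonormal_family_Parseval:
  fixes e :: "'n::finite \<Rightarrow> real^'n"
  assumes e: "\<And>i j. e i \<bullet> e j = (if i = j then 1 else 0)"
  shows "(\<Sum>j\<in>UNIV. (u \<bullet> e j) * (w \<bullet> e j)) = u \<bullet> w"
proof -
  define M where "M = (\<chi> i. e i)"
  have Mu: "M *v z = (\<chi> j. z \<bullet> e j)" for z
    by (simp add: M_def matrix_vector_mult_def inner_vec_def vec_eq_iff mult.commute)
  have "M ** transpose M = mat 1"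
    by (simp add: M_def matrix_matrix_mult_def transpose_def mat_def vec_eq_iff e[unfolded inner_vec_def, simplified])
  hence "transpose M ** M = mat 1" by (simp add: matrix_left_right_inverse)
  hence "transpose M *v (M *v w) = w" by (simp only: matrix_vector_mul_assoc matrix_vector_mul_lid)
  hence "u \<bullet> w = (M *v u) \<bullet> (M *v w)"
    using transpose_mult_vec_inner[of M "M *v w" u] by (simp only: inner_commute)
  thus ?thesis by (simp add: Mu inner_vec_def)
qed

context line_field
begin

text \<open>The sums of squared lengths are the traces of the orthogonal projections onto the complement of the
  line, of dimension \<open>p\<close>, and onto the part of the line orthogonal to \<open>\<theta>\<close>, of dimension \<open>q\<close>.\<close>
lemma trace_projections:
  fixes e :: "'n \<Rightarrow> real^'n"
  assumes e: "\<And>i j. e i \<bullet> e j = (if i = j then 1 else 0)" and \<theta>: "norm \<theta> = 1"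
    and n: "CARD('n) = p + q + 1"
  shows "(\<Sum>j\<in>UNIV. (norm (e j - P \<theta> (e j)))\<^sup>2) = real p"
    and "(\<Sum>j\<in>UNIV. (norm (P \<theta> (e j) - (\<theta> \<bullet> e j) *\<^sub>R \<theta>))\<^sup>2) = real q"
proof -
  note parseval = orthonormal_family_Parseval[OF e]
  have "\<theta> \<noteq> 0" using \<theta> by auto
  then obtain B where B: "finite B" "pairwise orthogonal B" "\<forall>b\<in>B. norm b = 1" "card B = q + 1"
    "\<forall>u. P \<theta> u = (\<Sum>b\<in>B. (b \<bullet> u) *\<^sub>R b)"
    using orthonormal_basis_of_line by blast
  have "(\<Sum>j\<in>UNIV. P \<theta> (e j) \<bullet> e j) = (\<Sum>j\<in>UNIV. \<Sum>b\<in>B. (b \<bullet> e j) * (b \<bullet> e j))"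
    by (simp add: B(5) inner_sum_left)
  also have "\<dots> = (\<Sum>b\<in>B. \<Sum>j\<in>UNIV. (b \<bullet> e j) * (b \<bullet> e j))" by (rule sum.swap)
  also have "\<dots> = real q + 1" using B(3,4) by (simp add: parseval norm_eq_1)
  finally have tr: "(\<Sum>j\<in>UNIV. P \<theta> (e j) \<bullet> e j) = real q + 1" .
  have PP: "P \<theta> (e j) \<bullet> P \<theta> (e j) = P \<theta> (e j) \<bullet> e j" for j by (rule P_inner)
  have "(norm (e j - P \<theta> (e j)))\<^sup>2 = 1 - P \<theta> (e j) \<bullet> e j" for j
    using PP[of j] e[of j j]
    by (simp add: power2_norm_eq_inner inner_diff_left inner_diff_right inner_commute[of "e j" "P \<theta> (e j)"])
  thus "(\<Sum>j\<in>UNIV. (norm (e j - P \<theta> (e j)))\<^sup>2) = real p"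
    using n by (simp add: sum_subtractf tr)
  have P\<theta>: "P \<theta> \<theta> = \<theta>" by (rule P_self[OF mem_L])
  have "(norm (P \<theta> (e j) - (\<theta> \<bullet> e j) *\<^sub>R \<theta>))\<^sup>2 = P \<theta> (e j) \<bullet> e j - (\<theta> \<bullet> e j) * (\<theta> \<bullet> e j)" for j
    using PP[of j] \<theta> P_inner_commute[of \<theta> "e j" \<theta>]
    by (simp add: power2_norm_eq_inner inner_diff_left inner_diff_right P\<theta> norm_eq_1
        inner_commute[of "e j" \<theta>] inner_commute[of "P \<theta> (e j)" \<theta>])
  thus "(\<Sum>j\<in>UNIV. (norm (P \<theta> (e j) - (\<theta> \<bullet> e j) *\<^sub>R \<theta>))\<^sup>2) = real q"
    using parseval[of \<theta> \<theta>] \<theta> by (simp add: sum_subtractf tr norm_eq_1)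
qed

text \<open>The Taylor coefficients of the Jacobian for a single function. The vectors \<open>V\<close> and \<open>W\<close> are \<open>v\<close> and \<open>w\<close>
  rescaled so that their Euclidean lengths are the Riemannian ones; \<open>m e0\<close> collects the terms in which \<open>\<nu>\<close>
  meets the gradient of \<open>\<theta> \<mapsto> \<theta> \<bullet> e0\<close>.\<close>
lemma second_variation_Jac:
  fixes x \<nu> v w :: "real^'n" and \<alpha> :: real
  assumes x: "x \<in> ball 0 1 - {0}" and n: "CARD('n) = p + q + 1"
    and v: "P (dir x) v = 0" and w: "P (dir x) w = w" "w \<bullet> dir x = 0"
    and \<nu>: "\<nu> = \<alpha> *\<^sub>R radial x + v + w" and unit: "g x \<nu> \<nu> = 1"
  defines "y \<equiv> log_radius CARD('n) q (rad x)"
    and "A \<equiv> \<lambda>s. ln (a_fun CARD('n) q s)" and "B \<equiv> \<lambda>s. ln (b_fun CARD('n) q s)"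
    and "C \<equiv> \<lambda>s. ln (c_fun CARD('n) q s)"
    and "V \<equiv> cosh (rad x) *\<^sub>R v" and "W \<equiv> (cosh (rad x))\<^sup>2 *\<^sub>R w"
  defines "\<eta>\<^sub>H \<equiv> a_fun CARD('n) q y / b_fun CARD('n) q y" and "\<eta>\<^sub>V \<equiv> a_fun CARD('n) q y / c_fun CARD('n) q y"
    and "Z \<equiv> deriv A y * \<alpha>\<^sup>2 + deriv B y * g x v v + deriv C y * g x w w"
    and "J \<equiv> \<lambda>\<kappa> e0 t. Jac g q x \<nu> t (\<lambda>\<theta>. \<kappa> + \<theta> \<bullet> e0)"
    and "s \<equiv> \<lambda>\<kappa> e0. \<kappa> + dir x \<bullet> e0"
  defines "m \<equiv> \<lambda>e0. \<alpha> * (\<eta>\<^sub>H * (V \<bullet> e0) + \<eta>\<^sub>V * (W \<bullet> e0))"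
  shows "g x v v = (norm V)\<^sup>2" "g x w w = (norm W)\<^sup>2"
    and "deriv (J \<kappa> e0) 0 = real CARD('n) * s \<kappa> e0 - s \<kappa> e0 * Z - m e0"
    and "(deriv ^^ 2) (J \<kappa> e0) 0 = (real CARD('n))\<^sup>2 * (s \<kappa> e0)\<^sup>2
      - 2 * real CARD('n) * s \<kappa> e0 * (s \<kappa> e0 * Z + m e0) - (s \<kappa> e0 * Z + m e0)\<^sup>2
      + (s \<kappa> e0)\<^sup>2 * (\<alpha>\<^sup>2 * (2 * (deriv A y)\<^sup>2 - (deriv ^^ 2) A y)
          + g x v v * (2 * (deriv B y)\<^sup>2 - (deriv ^^ 2) B y) + g x w w * (2 * (deriv C y)\<^sup>2 - (deriv ^^ 2) C y))
      + \<alpha>\<^sup>2 * \<eta>\<^sub>H\<^sup>2 * (norm (e0 - P (dir x) e0))\<^sup>2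
      + \<alpha>\<^sup>2 * \<eta>\<^sub>V\<^sup>2 * (norm (P (dir x) e0 - (dir x \<bullet> e0) *\<^sub>R dir x))\<^sup>2
      + 4 * s \<kappa> e0 * (deriv B y * (\<alpha> * \<eta>\<^sub>H * (V \<bullet> e0)) + deriv C y * (\<alpha> * \<eta>\<^sub>V * (W \<bullet> e0)))"
proof -
  let ?n = "CARD('n)" and ?r = "rad x" and ?\<theta> = "dir x"
  define e\<^sub>H e\<^sub>V where "e\<^sub>H = e0 - P ?\<theta> e0" and "e\<^sub>V = P ?\<theta> e0 - (?\<theta> \<bullet> e0) *\<^sub>R ?\<theta>"
  have n1: "?n \<ge> 1" by (simp add: Suc_leI)
  note pc = polar_coordinates[OF x]
  have c0: "cosh ?r > 0" by (rule cosh_real_pos)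
  have P\<theta>: "P ?\<theta> ?\<theta> = ?\<theta>" by (rule P_self[OF mem_L])
  note line = gram_op_polar_line[OF pc(1) less_imp_neq[OF pc(2), symmetric], folded pc(4)]
  note orth = gram_op_polar_orthogonal[OF pc(1) less_imp_neq[OF pc(2), symmetric], folded pc(4)]
  show gv: "g x v v = (norm V)\<^sup>2"
    by (simp add: metric_eq_inner_gram_op orth[OF v] V_def power_mult_distrib power2_norm_eq_inner)
  show gw: "g x w w = (norm W)\<^sup>2"
    by (simp add: metric_eq_inner_gram_op line[OF w(1)] W_def power_mult_distrib power2_norm_eq_inner flip: power_mult)
  have v\<theta>: "v \<bullet> ?\<theta> = 0" and vw: "v \<bullet> w = 0"
    using P_inner_commute[of ?\<theta> v ?\<theta>] P_inner_commute[of ?\<theta> v w] by (simp_all add: v w P\<theta>)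
  have "g x \<nu> \<nu> = \<alpha>\<^sup>2 + g x v v + g x w w"
    unfolding metric_eq_inner_gram_op \<nu> radial_eq linear_add[OF linear_gram_op] linear_cmul[OF linear_gram_op]
      line[OF P\<theta>] line[OF w(1)] orth[OF v]
    using pc(1) c0 v\<theta> vw w(2)
    by (simp add: inner_add_left inner_add_right inner_commute[of ?\<theta> v] inner_commute[of ?\<theta> w]
        inner_commute[of w v] norm_eq_1 power2_eq_square power4_eq_xxxx)
  hence sum: "\<alpha>\<^sup>2 + g x v v + g x w w = 1" using unit by simp
  have ratio: "exp (2 * (ln a - ln a')) = (a / a')\<^sup>2" if "a > 0" "a' > 0" for a a' :: real
  proof -
    have "exp (2 * (ln a - ln a')) = (exp (ln a - ln a'))\<^sup>2" by (rule exp_double)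
    thus ?thesis using that by (simp add: exp_diff)
  qed
  have pos: "a_fun ?n q z > 0" "b_fun ?n q z > 0" "c_fun ?n q z > 0" for z
    using a_fun_pos[OF n1] r_of_pos[OF n1, of q z] by (simp_all add: b_fun_def c_fun_def)
  have He: "V \<bullet> e\<^sub>H = V \<bullet> e0"
    using P_inner_commute[of ?\<theta> v e0] by (simp add: V_def e\<^sub>H_def inner_diff_right v)
  have We: "W \<bullet> e\<^sub>V = W \<bullet> e0"
    using P_inner_commute[of ?\<theta> w e0] by (simp add: W_def e\<^sub>V_def inner_diff_right w)
  have sq: "(norm (X - (\<alpha> * t * k) *\<^sub>R e))\<^sup>2 = (norm X)\<^sup>2 - 2 * (\<alpha> * k * (X \<bullet> e)) * t + \<alpha>\<^sup>2 * k\<^sup>2 * (norm e)\<^sup>2 * t\<^sup>2"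
    for X e :: "real^'n" and k t
    unfolding power2_norm_eq_inner
    by (simp add: inner_diff_left inner_diff_right inner_commute[of e X] power2_eq_square algebra_simps)
  have "J \<kappa> e0 t = exp (real ?n * t * s \<kappa> e0) * sqrt (\<alpha>\<^sup>2 * exp (2 * (A y - A (y + t * s \<kappa> e0)))
        + exp (2 * (B y - B (y + t * s \<kappa> e0))) * (g x v v - 2 * (\<alpha> * \<eta>\<^sub>H * (V \<bullet> e0)) * t + (\<alpha>\<^sup>2 * \<eta>\<^sub>H\<^sup>2 * (norm e\<^sub>H)\<^sup>2) * t\<^sup>2)
        + exp (2 * (C y - C (y + t * s \<kappa> e0))) * (g x w w - 2 * (\<alpha> * \<eta>\<^sub>V * (W \<bullet> e0)) * t + (\<alpha>\<^sup>2 * \<eta>\<^sub>V\<^sup>2 * (norm e\<^sub>V)\<^sup>2) * t\<^sup>2))" for t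
    unfolding J_def Jac_eq[OF x n v w \<nu>] A_def B_def C_def ratio[OF pos(1) pos(1)] ratio[OF pos(2) pos(2)]
      ratio[OF pos(3) pos(3)] gv gw sq[symmetric] He[symmetric] We[symmetric]
    by (simp only: V_def W_def \<eta>\<^sub>H_def \<eta>\<^sub>V_def y_def s_def e\<^sub>H_def e\<^sub>V_def)
  note r = second_order_Jacobian[OF radial_profiles_twice_differentiable[OF n1, of q, folded A_def B_def C_def] sum this Z_def[THEN meta_eq_to_obj_eq]]
  show "deriv (J \<kappa> e0) 0 = real CARD('n) * s \<kappa> e0 - s \<kappa> e0 * Z - m e0"
    using r(1) by (simp add: m_def algebra_simps)
  have m: "\<alpha> * \<eta>\<^sub>H * (V \<bullet> e0) + \<alpha> * \<eta>\<^sub>V * (W \<bullet> e0) = m e0"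
    by (simp add: m_def algebra_simps)
  show "(deriv ^^ 2) (J \<kappa> e0) 0 = (real CARD('n))\<^sup>2 * (s \<kappa> e0)\<^sup>2
      - 2 * real CARD('n) * s \<kappa> e0 * (s \<kappa> e0 * Z + m e0) - (s \<kappa> e0 * Z + m e0)\<^sup>2
      + (s \<kappa> e0)\<^sup>2 * (\<alpha>\<^sup>2 * (2 * (deriv A y)\<^sup>2 - (deriv ^^ 2) A y)
          + g x v v * (2 * (deriv B y)\<^sup>2 - (deriv ^^ 2) B y) + g x w w * (2 * (deriv C y)\<^sup>2 - (deriv ^^ 2) C y))
      + \<alpha>\<^sup>2 * \<eta>\<^sub>H\<^sup>2 * (norm (e0 - P (dir x) e0))\<^sup>2
      + \<alpha>\<^sup>2 * \<eta>\<^sub>V\<^sup>2 * (norm (P (dir x) e0 - (dir x \<bullet> e0) *\<^sub>R dir x))\<^sup>2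
      + 4 * s \<kappa> e0 * (deriv B y * (\<alpha> * \<eta>\<^sub>H * (V \<bullet> e0)) + deriv C y * (\<alpha> * \<eta>\<^sub>V * (W \<bullet> e0)))"
    using r(2)[unfolded m] by (simp only: e\<^sub>H_def e\<^sub>V_def)
qed

end

context line_field
begin

text \<open>The theorem for an arbitrary field of lines. Each second variation is written as a combination of
  products \<open>(u \<bullet> e\<^sub>j) (u' \<bullet> e\<^sub>j)\<close> and of the two squared gradients, so that Parseval's identity and the trace
  formulas sum it; \<open>\<theta>\<close> is orthogonal to \<open>V\<close> and \<open>W\<close>, and all mixed products disappear.\<close>
lemma sum_second_variations:
  fixes x \<nu> v w :: "real^'n" and \<alpha> :: real and e :: "'n \<Rightarrow> real^'n"
  assumes x: "x \<in> ball 0 1 - {0}" and n: "CARD('n) = p + q + 1"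
    and v: "P (dir x) v = 0" and w: "P (dir x) w = w" "w \<bullet> dir x = 0"
    and \<nu>: "\<nu> = \<alpha> *\<^sub>R radial x + v + w" and unit: "g x \<nu> \<nu> = 1"
    and e: "\<And>i j. e i \<bullet> e j = (if i = j then 1 else 0)"
  defines "y \<equiv> log_radius CARD('n) q (rad x)"
    and "A \<equiv> \<lambda>s. ln (a_fun CARD('n) q s)" and "B \<equiv> \<lambda>s. ln (b_fun CARD('n) q s)"
    and "C \<equiv> \<lambda>s. ln (c_fun CARD('n) q s)"
  defines "\<eta>\<^sub>H \<equiv> a_fun CARD('n) q y / b_fun CARD('n) q y" and "\<eta>\<^sub>V \<equiv> a_fun CARD('n) q y / c_fun CARD('n) q y"
    and "Z \<equiv> deriv A y * \<alpha>\<^sup>2 + deriv B y * g x v v + deriv C y * g x w w"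
  shows "(\<Sum>j\<in>UNIV. (deriv ^^ 2) (\<lambda>t. Jac g q x \<nu> t (\<lambda>\<theta>. g 0 \<theta> (e j))) 0)
           - real CARD('n) * deriv (\<lambda>t. Jac g q x \<nu> t (\<lambda>\<theta>. 1)) 0
       = - real CARD('n) * Z - Z\<^sup>2
         + \<alpha>\<^sup>2 * (- (deriv ^^ 2) A y + 2 * (deriv A y)\<^sup>2
                  + \<eta>\<^sub>H\<^sup>2 * (real p - g x v v) + \<eta>\<^sub>V\<^sup>2 * (real q - g x w w))
         + g x v v * (- (deriv ^^ 2) B y + 2 * (deriv B y)\<^sup>2)
         + g x w w * (- (deriv ^^ 2) C y + 2 * (deriv C y)\<^sup>2)"
proof -
  let ?n = "real CARD('n)"
  define \<theta> where "\<theta> = dir x"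
  define V W where "V = cosh (rad x) *\<^sub>R v" and "W = (cosh (rad x))\<^sup>2 *\<^sub>R w"
  define U where "U = \<alpha> *\<^sub>R (\<eta>\<^sub>H *\<^sub>R V + \<eta>\<^sub>V *\<^sub>R W)"
  define Q where "Q = \<alpha>\<^sup>2 * (2 * (deriv A y)\<^sup>2 - (deriv ^^ 2) A y)
     + g x v v * (2 * (deriv B y)\<^sup>2 - (deriv ^^ 2) B y) + g x w w * (2 * (deriv C y)\<^sup>2 - (deriv ^^ 2) C y)"
  note sv = second_variation_Jac[OF x n v w \<nu> unit, folded y_def A_def B_def C_def, folded \<eta>\<^sub>H_def \<eta>\<^sub>V_def Z_def Q_def,
      folded V_def W_def \<theta>_def]
  have U: "\<alpha> * (\<eta>\<^sub>H * (V \<bullet> e0) + \<eta>\<^sub>V * (W \<bullet> e0)) = U \<bullet> e0" for e0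
    by (simp add: U_def inner_add_left)
  have pc: "norm \<theta> = 1" unfolding \<theta>_def by (rule polar_coordinates[OF x])
  have P\<theta>: "P \<theta> \<theta> = \<theta>" by (rule P_self[OF mem_L])
  have PV: "P \<theta> V = 0" and PW: "P \<theta> W = W"
    by (simp_all add: V_def W_def \<theta>_def v w linear_cmul[OF linear_P])
  have V\<theta>: "\<theta> \<bullet> V = 0" and VW: "V \<bullet> W = 0"
    using P_inner_commute[of \<theta> \<theta> V] P_inner_commute[of \<theta> V W] by (simp_all add: PV PW P\<theta>)
  have W\<theta>: "\<theta> \<bullet> W = 0" using w(2) by (simp add: W_def \<theta>_def inner_commute)
  have U\<theta>: "\<theta> \<bullet> U = 0" by (simp add: U_def inner_add_right V\<theta> W\<theta>)
  have UU: "U \<bullet> U = \<alpha>\<^sup>2 * (\<eta>\<^sub>H\<^sup>2 * g x v v + \<eta>\<^sub>V\<^sup>2 * g x w w)"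
    unfolding sv(1,2) power2_norm_eq_inner
    by (simp add: U_def inner_add_left inner_add_right VW inner_commute[of W V] power2_eq_square algebra_simps)
  note parseval = orthonormal_family_Parseval[OF e]
  have first: "deriv (\<lambda>t. Jac g q x \<nu> t (\<lambda>\<theta>. 1)) 0 = ?n - Z"
    using sv(3)[of 1 0] by simp
  have second: "(deriv ^^ 2) (\<lambda>t. Jac g q x \<nu> t (\<lambda>\<theta>. g 0 \<theta> (e j))) 0
      = (?n\<^sup>2 - 2 * ?n * Z - Z\<^sup>2 + Q) * ((\<theta> \<bullet> e j) * (\<theta> \<bullet> e j))
        - 2 * (?n + Z) * ((\<theta> \<bullet> e j) * (U \<bullet> e j)) - (U \<bullet> e j) * (U \<bullet> e j)
        + 4 * \<alpha> * \<eta>\<^sub>H * deriv B y * ((\<theta> \<bullet> e j) * (V \<bullet> e j))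
        + 4 * \<alpha> * \<eta>\<^sub>V * deriv C y * ((\<theta> \<bullet> e j) * (W \<bullet> e j))
        + \<alpha>\<^sup>2 * \<eta>\<^sub>H\<^sup>2 * (norm (e j - P \<theta> (e j)))\<^sup>2
        + \<alpha>\<^sup>2 * \<eta>\<^sub>V\<^sup>2 * (norm (P \<theta> (e j) - (\<theta> \<bullet> e j) *\<^sub>R \<theta>))\<^sup>2" for j
    using sv(4)[of 0 "e j", unfolded U]
    by (simp add: metric_0) (simp add: power2_eq_square algebra_simps)
  have "(\<Sum>j\<in>UNIV. (deriv ^^ 2) (\<lambda>t. Jac g q x \<nu> t (\<lambda>\<theta>. g 0 \<theta> (e j))) 0)
      = (?n\<^sup>2 - 2 * ?n * Z - Z\<^sup>2 + Q) - U \<bullet> U + \<alpha>\<^sup>2 * \<eta>\<^sub>H\<^sup>2 * real p + \<alpha>\<^sup>2 * \<eta>\<^sub>V\<^sup>2 * real q"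
    unfolding second sum.distrib sum_subtractf sum_distrib_left[symmetric] parseval
      trace_projections[OF e pc n] U\<theta> V\<theta> W\<theta>
    using pc by (simp add: norm_eq_1)
  thus ?thesis unfolding first UU Q_def by (simp add: algebra_simps power2_eq_square)
qed

end

theorem theorem2p6:
  fixes g :: "'n::finite metric" and e :: "'n \<Rightarrow> real^'n"
    and x \<nu> v w :: "real^'n" and m n p q :: nat
    and \<alpha> \<beta> \<gamma> y \<eta>\<^sub>H \<eta>\<^sub>V Z :: real and A B C :: "real \<Rightarrow> real"
  assumes M: "complex_hyperbolic m g \<and> p = 2 * m - 2 \<and> q = 1
            \<or> quaternionic_hyperbolic m g \<and> p = 4 * m - 4 \<and> q = 3
            \<or> octonionic_hyperbolic_plane g \<and> p = 8 \<and> q = 7"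
    and n: "n = p + q + 1"
    and e: "\<forall>i j. g 0 (e i) (e j) = (if i = j then 1 else 0)"
    and x: "x \<in> ball 0 1 - {0}"
    and \<nu>: "g x \<nu> \<nu> = 1"
    and decomp: "\<nu> = \<alpha> *\<^sub>R radial x + v + w" "v \<in> hspace_at g x" "w \<in> vspace_at g x"
    and \<beta>: "\<beta> = g x v v" and \<gamma>: "\<gamma> = g x w w"
    and y: "y = log_radius n q (rad x)"
    and A: "A = (\<lambda>s. ln (a_fun n q s))"
    and B: "B = (\<lambda>s. ln (b_fun n q s))"
    and C: "C = (\<lambda>s. ln (c_fun n q s))"
    and \<eta>: "\<eta>\<^sub>H = a_fun n q y / b_fun n q y" "\<eta>\<^sub>V = a_fun n q y / c_fun n q y"
    and Z: "Z = deriv A y * \<alpha>\<^sup>2 + deriv B y * \<beta> + deriv C y * \<gamma>"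
  shows "(\<Sum>j\<in>UNIV. (deriv ^^ 2) (\<lambda>t. Jac g q x \<nu> t (\<lambda>\<theta>. g 0 \<theta> (e j))) 0)
           - real n * deriv (\<lambda>t. Jac g q x \<nu> t (\<lambda>\<theta>. 1)) 0
       = - real n * Z - Z\<^sup>2
         + \<alpha>\<^sup>2 * (- (deriv ^^ 2) A y + 2 * (deriv A y)\<^sup>2
                  + \<eta>\<^sub>H\<^sup>2 * (real p - \<beta>) + \<eta>\<^sub>V\<^sup>2 * (real q - \<gamma>))
         + \<beta> * (- (deriv ^^ 2) B y + 2 * (deriv B y)\<^sup>2)
         + \<gamma> * (- (deriv ^^ 2) C y + 2 * (deriv C y)\<^sup>2)"
proof -
  \<comment> \<open>This excludes \<open>m = 0\<close>, so that the subtractions in \<open>p\<close> are not truncated.\<close>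
  have "0 < CARD('n)" by simp
  hence "\<exists>L T. line_field L T q \<and> g = ball_metric L \<and> CARD('n) = n"
    using M
  proof (elim disjE conjE)
    assume c: "complex_hyperbolic m g" and pq: "p = 2 * m - 2" "q = 1" and "0 < CARD('n)"
    have "CARD('n) = 2 * m" using c by (simp add: complex_hyperbolic_def)
    hence "CARD('n) = n" using pq \<open>0 < CARD('n)\<close> n by simp
    moreover obtain L T where "line_field L T q" "g = ball_metric L"
      using complex_hyperbolic_line_field[OF c] pq(2) by metis
    ultimately show ?thesis by blast
  next
    assume c: "quaternionic_hyperbolic m g" and pq: "p = 4 * m - 4" "q = 3" and "0 < CARD('n)"
    have "CARD('n) = 4 * m" using c by (simp add: quaternionic_hyperbolic_def)
    hence "CARD('n) = n" using pq \<open>0 < CARD('n)\<close> n by simp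
    moreover obtain L T where "line_field L T q" "g = ball_metric L"
      using quaternionic_hyperbolic_line_field[OF c] pq(2) by metis
    ultimately show ?thesis by blast
  next
    assume c: "octonionic_hyperbolic_plane g" and pq: "p = 8" "q = 7"
    have "CARD('n) = 16" using c by (simp add: octonionic_hyperbolic_plane_def)
    hence "CARD('n) = n" using pq n by simp
    moreover obtain L T where "line_field L T q" "g = ball_metric L"
      using octonionic_hyperbolic_plane_line_field[OF c] pq(2) by metis
    ultimately show ?thesis by blast
  qed
  then obtain L T where L: "line_field L T q" and g: "g = ball_metric L" and card: "CARD('n) = n"
    by blast
  interpret line_field L T q by (rule L)
  have \<theta>: "norm (dir x) = 1" by (rule polar_coordinates[OF x])
  obtain v0 where v0: "v = tanh (rad x) *\<^sub>R v0" "v0 \<in> hspace g (dir x)"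
    using decomp(2) by (auto simp: hspace_at_def frechet_derivative_polar)
  obtain w0 where w0: "w = tanh (rad x) *\<^sub>R w0" "w0 \<in> vspace g (dir x)"
    using decomp(3) by (auto simp: vspace_at_def frechet_derivative_polar)
  have v: "closest_point (L (dir x)) v = 0"
    using hspace_orthogonal[OF \<theta> v0(2)[unfolded g]] by (simp add: v0(1) linear_cmul[OF linear_P])
  have w: "closest_point (L (dir x)) w = w" "w \<bullet> dir x = 0"
    using vspace_mem[OF \<theta> w0(2)[unfolded g]] by (simp_all add: w0(1) linear_cmul[OF linear_P])
  have e': "e i \<bullet> e j = (if i = j then 1 else 0)" for i j
    using e by (simp add: g metric_0)
  show ?thesis
    using sum_second_variations[OF x card[unfolded n] v w decomp(1) \<nu>[unfolded g] e']
    unfolding Z \<eta> A B C \<beta> \<gamma> y g card .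
qed

end
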